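(* Let $\mathcal P=(Q,R)$ be a parameterized tree system, let $A_I=(Q_I,F_I,\delta_I)$ be a tree automaton over $\mathcal F_Q$ with $Init=\{\tau\text{ complete}\mid t_\tau\in L(A_I)\}$, let $Unsafe$ be a finitely based set of configurations and $A_U=(Q_U,F_U,\delta_U)$ a tree automaton over $\mathcal F_Q$ with $Unsafe=\{\tau\text{ complete}\mid t_\tau\in L(A_U)\}$, and let $\Phi_R,\Phi_I,\Phi_U$ be the first-order translations in the context. Let $U_0=Unsafe$ and $U_{i+1}=U_i\cup Pre(U_i)$. Assume that $U_{n+1}=U_n$ for some $n$ and that $Init\cap U_n=\emptyset$. Then the sentence $\Phi_R\wedge\Phi_I\wedge\Phi_U\wedge\neg\exists x\exists y\,(Init(x)\wedge Unsafe(y)\wedge R(x,y))$ (conjunction of all sentences of the three sets) has a finite model.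
   Context: Trees over a finite set $Q$: $(S,\lambda)$ with $S$ a finite nonempty prefix-closed set of sequences over $\{0,1\}$ such that $s1\in S$ implies $s0\in S$, and $\lambda:S\to Q$. A tree is complete if every node has 0 or 2 children; configurations are complete trees. A parameterized tree system is $\mathcal P=(Q,R)$ with $Q$ finite and $R$ a finite set of trees over $Q\times Q$ (rules). An occurrence of a rule $r=(S_r,\lambda_r)$ in a complete tree $\tau=(S,\lambda)$ is a map $\varphi:S_r\to S$ such that for each $s\in S_r$: if $s$ has two children then $\varphi(s0)=\varphi(s)0,\varphi(s1)=\varphi(s)1$; if $s$ has exactly one child $s0$ then $\varphi(s0)\in\{\varphi(s)0,\varphi(s)1\}\cap S$; and $\lambda(\varphi(s))$ is the first component of $\lambda_r(s)$. $\tau\Rightarrow_{\mathcal P}\tau'$ iff for some rule and occurrence, $\tau'$ is $\tau$ with each $\varphi(s)$ relabelled by the second component of $\lambda_r(s)$. Embedding: $\tau_1=(S_1,\lambda_1)\preceq\tau_2=(S_2,\lambda_2)$ iff there is an injective $f:S_1\to S_2$ with $\lambda_2(f(s))=\lambda_1(s)$ and, whenever $sb\in S_1$, $f(s)b$ is a prefix of $f(sb)$. A set of configurations is finitely based if it equals $\{\tau\text{ complete}\mid\exists\beta\in B,\beta\preceq\tau\}$ for a finite set $B$ of trees. Monotonic abstraction: for configurations, $\tau_1\Rightarrow^{\mathcal A}_{\mathcal P}\tau_2$ iff there is a configuration $\tau'$ with $\tau'\preceq\tau_1$ and $\tau'\Rightarrow_{\mathcal P}\tau_2$; for a set $U$ of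 configurations, $Pre(U)=\{\tau\mid\exists\tau'\in U,\ \tau\Rightarrow^{\mathcal A}_{\mathcal P}\tau'\}$. $\mathcal F_Q$: binary function symbols $f_q$ ($q\in Q$) and a constant $e$. $t_\tau=f_q(e,e)$ for a single node $q$; $t_\tau=f_q(t_{\tau_1},t_{\tau_2})$ for $\tau=q(\tau_1,\tau_2)$. For a tree $\tau$ over $Q\times Q$: $s_\tau=\{\langle f_{q_1}(e,e),f_{q_2}(e,e)\rangle\}$ for a single node $(q_1,q_2)$; for $\tau=(q_1,q_2)(\tau_1,\tau_2)$, $s_\tau=\{\langle f_{q_1}(\rho_1,\rho_2),f_{q_2}(\rho_3,\rho_4)\rangle\mid\langle\rho_1,\rho_3\rangle\in s_{\tau_1},\langle\rho_2,\rho_4\rangle\in s_{\tau_2}\}$; for $\tau=(q_1,q_2)(\tau_1)$, $s_\tau$ consists of all $\langle f_{q_1}(\rho_1,e),f_{q_2}(\rho_2,e)\rangle$ and $\langle f_{q_1}(e,\rho_1),f_{q_2}(e,\rho_2)\rangle$ with $\langle\rho_1,\rho_2\rangle\in s_{\tau_1}$. $\rho_i^{gen}$: replace every occurrence of $e$ by a variable, distinct positions distinct variables, the same position in $\rho_1$ and $\rho_2$ the same variable. $\Phi_R$: universal closures of $R(\rho_1^{gen},\rho_2^{gen})$ for each $r\in R$ and $\langle\rho_1,\rho_2\rangle\in s_r$; $R(x,x)$; $R(x,y)\wedge R(y,z)\to R(x,z)$; $R(x,y)\wedge R(z,v)\to R(f_q(x,z),f_q(y,v))$ for each $q\in Q$.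 $\Phi_I$ (unary predicates $I_\theta$, $\theta\in Q_I$, and $Init$): universal closures of $I_\theta(f_q(e,e))$ for all $\theta'$ with $\to^e\theta'$ and $(\theta',\theta')\to^{f_q}\theta$ in $\delta_I$; $I_{\theta_1}(x)\wedge I_{\theta_2}(y)\to I_{\theta_3}(f_q(x,y))$ for each $(\theta_1,\theta_2)\to^{f_q}\theta_3$ in $\delta_I$; $\bigvee_{\theta\in F_I}I_\theta(x)\to Init(x)$. $\Phi_U$ (predicates $U_\theta$, $\theta\in Q_U$, and $Unsafe$): the same three schemes built from $A_U$. Tree automata are nondeterministic bottom-up with the usual runs and acceptance. *)

theory Defs
  imports Main "HOL-Library.Sublist" "HOL-Library.Countable"
begin

section \<open>Trees\<close>

text \<open>
  A tree \<open>(S, \<lambda>)\<close> is a partial map whose domain is \<open>S\<close>. The letters 0 and 1 of a position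
  are \<^term>\<open>False\<close> and \<^term>\<open>True\<close>.
\<close>

type_synonym pos = "bool list"
type_synonym 'q tree = "pos \<rightharpoonup> 'q"

definition is_tree :: "'q set \<Rightarrow> 'q tree \<Rightarrow> bool" where
  "is_tree Q \<tau> \<longleftrightarrow> finite (dom \<tau>) \<and> dom \<tau> \<noteq> {} \<and>
     (\<forall>s\<in>dom \<tau>. \<forall>p. prefix p s \<longrightarrow> p \<in> dom \<tau>) \<and>
     (\<forall>s. s @ [True] \<in> dom \<tau> \<longrightarrow> s @ [False] \<in> dom \<tau>) \<and>
     ran \<tau> \<subseteq> Q"

definition complete_tree :: "'q set \<Rightarrow> 'q tree \<Rightarrow> bool" where
  "complete_tree Q \<tau> \<longleftrightarrow> is_tree Q \<tau> \<and>
     (\<forall>s\<in>dom \<tau>. s @ [False] \<in> dom \<tau> \<longleftrightarrow> s @ [True] \<in> dom \<tau>)"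

definition embedding :: "(pos \<Rightarrow> pos) \<Rightarrow> 'q tree \<Rightarrow> 'q tree \<Rightarrow> bool" where
  "embedding f \<tau>1 \<tau>2 \<longleftrightarrow> inj_on f (dom \<tau>1) \<and> f ` dom \<tau>1 \<subseteq> dom \<tau>2 \<and>
     (\<forall>s\<in>dom \<tau>1. \<tau>2 (f s) = \<tau>1 s) \<and>
     (\<forall>s b. s @ [b] \<in> dom \<tau>1 \<longrightarrow> prefix (f s @ [b]) (f (s @ [b])))"

definition embeds :: "'q tree \<Rightarrow> 'q tree \<Rightarrow> bool"  (infix \<open>\<preceq>\<close> 50) where
  "\<tau>1 \<preceq> \<tau>2 \<longleftrightarrow> (\<exists>f. embedding f \<tau>1 \<tau>2)"

definition finitely_based :: "'q set \<Rightarrow> 'q tree set \<Rightarrow> bool" where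
  "finitely_based Q U \<longleftrightarrow>
     (\<exists>B. finite B \<and> (\<forall>\<beta>\<in>B. is_tree Q \<beta>) \<and> U = {\<tau>. complete_tree Q \<tau> \<and> (\<exists>\<beta>\<in>B. \<beta> \<preceq> \<tau>)})"


section \<open>Parameterized tree systems\<close>

definition parameterized_tree_system :: "'q set \<Rightarrow> ('q \<times> 'q) tree set \<Rightarrow> bool" where
  "parameterized_tree_system Q R \<longleftrightarrow> finite Q \<and> finite R \<and> (\<forall>r\<in>R. is_tree (Q \<times> Q) r)"

definition occurrence :: "(pos \<Rightarrow> pos) \<Rightarrow> ('q \<times> 'q) tree \<Rightarrow> 'q tree \<Rightarrow> bool" where
  "occurrence \<phi> r \<tau> \<longleftrightarrow> \<phi> ` dom r \<subseteq> dom \<tau> \<and>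
     (\<forall>s\<in>dom r.
        (s @ [False] \<in> dom r \<and> s @ [True] \<in> dom r \<longrightarrow>
           \<phi> (s @ [False]) = \<phi> s @ [False] \<and> \<phi> (s @ [True]) = \<phi> s @ [True]) \<and>
        (s @ [False] \<in> dom r \<and> s @ [True] \<notin> dom r \<longrightarrow>
           \<phi> (s @ [False]) \<in> {\<phi> s @ [False], \<phi> s @ [True]} \<inter> dom \<tau>) \<and>
        \<tau> (\<phi> s) = map_option fst (r s))"

text \<open>Occurrences are injective on the positions of the rule, so the relabelling is consistent.\<close>

definition step :: "'q set \<Rightarrow> ('q \<times> 'q) tree set \<Rightarrow> 'q tree \<Rightarrow> 'q tree \<Rightarrow> bool" where
  "step Q R \<tau> \<tau>' \<longleftrightarrow> complete_tree Q \<tau> \<and>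
     (\<exists>r\<in>R. \<exists>\<phi>. occurrence \<phi> r \<tau> \<and>
        (\<forall>s\<in>dom r. \<tau>' (\<phi> s) = map_option snd (r s)) \<and>
        (\<forall>p. p \<notin> \<phi> ` dom r \<longrightarrow> \<tau>' p = \<tau> p))"

definition abstract_step :: "'q set \<Rightarrow> ('q \<times> 'q) tree set \<Rightarrow> 'q tree \<Rightarrow> 'q tree \<Rightarrow> bool" where
  "abstract_step Q R \<tau>1 \<tau>2 \<longleftrightarrow> complete_tree Q \<tau>1 \<and> complete_tree Q \<tau>2 \<and>
     (\<exists>\<tau>'. complete_tree Q \<tau>' \<and> \<tau>' \<preceq> \<tau>1 \<and> step Q R \<tau>' \<tau>2)"

definition Pre :: "'q set \<Rightarrow> ('q \<times> 'q) tree set \<Rightarrow> 'q tree set \<Rightarrow> 'q tree set" where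
  "Pre Q R U = {\<tau>. complete_tree Q \<tau> \<and> (\<exists>\<tau>'\<in>U. abstract_step Q R \<tau> \<tau>')}"


section \<open>Terms and tree automata\<close>

text \<open>First-order terms over the binary symbols \<open>f\<^sub>q\<close> and the constant \<open>e\<close>.\<close>

datatype 'q tm = Var nat | E | F 'q "'q tm" "'q tm"

definition subtree :: "'q tree \<Rightarrow> bool \<Rightarrow> 'q tree" where
  "subtree \<tau> b = (\<lambda>s. \<tau> (b # s))"

lemma card_dom_subtree:
  assumes "finite (dom \<tau>)" "[] \<in> dom \<tau>"
  shows "card (dom (subtree \<tau> b)) < card (dom \<tau>)"
proof -
  have "(#) b ` dom (subtree \<tau> b) \<subseteq> dom \<tau> - {[]}"
    by (auto simp: subtree_def dom_def)
  then have "card ((#) b ` dom (subtree \<tau> b)) \<le> card (dom \<tau> - {[]})"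
    using assms(1) by (intro card_mono) auto
  also have "\<dots> < card (dom \<tau>)"
    using assms by (rule card_Diff1_less)
  finally show ?thesis
    by (simp add: card_image)
qed

text \<open>
  The term \<open>t\<^sub>\<tau>\<close> of a complete tree. The outer guard holds for every tree; it only makes the
  recursion total on arbitrary partial maps. The values on incomplete trees are irrelevant.
\<close>

function tree_term :: "'q tree \<Rightarrow> 'q tm" where
  "tree_term \<tau> =
     (if finite (dom \<tau>) \<and> [] \<in> dom \<tau> then
        if [False] \<notin> dom \<tau> then F (the (\<tau> [])) E E
        else F (the (\<tau> [])) (tree_term (subtree \<tau> False)) (tree_term (subtree \<tau> True))
      else E)"
  by auto
termination
  by (relation "measure (\<lambda>\<tau>. card (dom \<tau>))") (auto simp: card_dom_subtree)

text \<open>The set \<open>s\<^sub>\<tau>\<close> of a tree over \<open>Q \<times> Q\<close>, with the same outer guard.\<close>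

function rule_terms :: "('q \<times> 'q) tree \<Rightarrow> ('q tm \<times> 'q tm) set" where
  "rule_terms \<tau> =
     (if finite (dom \<tau>) \<and> [] \<in> dom \<tau> then
        let q1 = fst (the (\<tau> [])); q2 = snd (the (\<tau> [])) in
        if [False] \<notin> dom \<tau> then {(F q1 E E, F q2 E E)}
        else if [True] \<in> dom \<tau> then
          {(F q1 \<rho>1 \<rho>2, F q2 \<rho>3 \<rho>4) | \<rho>1 \<rho>2 \<rho>3 \<rho>4.
             (\<rho>1, \<rho>3) \<in> rule_terms (subtree \<tau> False) \<and> (\<rho>2, \<rho>4) \<in> rule_terms (subtree \<tau> True)}
        else
          {(F q1 \<rho>1 E, F q2 \<rho>2 E) | \<rho>1 \<rho>2. (\<rho>1, \<rho>2) \<in> rule_terms (subtree \<tau> False)} \<union>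
          {(F q1 E \<rho>1, F q2 E \<rho>2) | \<rho>1 \<rho>2. (\<rho>1, \<rho>2) \<in> rule_terms (subtree \<tau> False)}
      else {})"
  by auto
termination
  by (relation "measure (\<lambda>\<tau>. card (dom \<tau>))") (auto simp: card_dom_subtree)

declare tree_term.simps [simp del] rule_terms.simps [simp del]

text \<open>
  \<open>\<rho>\<^sup>g\<^sup>e\<^sup>n\<close> is \<^term>\<open>gen [] \<rho>\<close>: the occurrence of \<open>e\<close> at position \<open>p\<close> becomes the variable
  indexed by (the code of) \<open>p\<close>.
\<close>

primrec gen :: "pos \<Rightarrow> 'q tm \<Rightarrow> 'q tm" where
  "gen p (Var x) = Var x"
| "gen p E = Var (to_nat p)"
| "gen p (F q t1 t2) = F q (gen (p @ [False]) t1) (gen (p @ [True]) t2)"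

text \<open>
  Nondeterministic bottom-up automata: \<open>\<theta> \<in> leaf_rules A\<close> is the transition \<open>\<rightarrow>\<^sup>e \<theta>\<close>, and
  \<open>(q, \<theta>1, \<theta>2, \<theta>3) \<in> node_rules A\<close> is the transition from \<open>(\<theta>1, \<theta>2)\<close> to \<open>\<theta>3\<close> labelled \<open>f\<^sub>q\<close>.
\<close>

record ('q, 's) ta =
  states :: "'s set"
  final :: "'s set"
  leaf_rules :: "'s set"
  node_rules :: "('q \<times> 's \<times> 's \<times> 's) set"

definition tree_automaton :: "'q set \<Rightarrow> ('q, 's) ta \<Rightarrow> bool" where
  "tree_automaton Q A \<longleftrightarrow> finite (states A) \<and> final A \<subseteq> states A \<and> leaf_rules A \<subseteq> states A \<and>
     node_rules A \<subseteq> Q \<times> states A \<times> states A \<times> states A"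

inductive run :: "('q, 's) ta \<Rightarrow> 'q tm \<Rightarrow> 's \<Rightarrow> bool" for A where
  "\<theta> \<in> leaf_rules A \<Longrightarrow> run A E \<theta>"
| "run A t1 \<theta>1 \<Longrightarrow> run A t2 \<theta>2 \<Longrightarrow> (q, \<theta>1, \<theta>2, \<theta>3) \<in> node_rules A \<Longrightarrow> run A (F q t1 t2) \<theta>3"

definition language :: "('q, 's) ta \<Rightarrow> 'q tm set" where
  "language A = {t. \<exists>\<theta>\<in>final A. run A t \<theta>}"


section \<open>First-order logic over \<open>\<F>\<^sub>Q\<close>\<close>

datatype ('q, 'p) fm =
    Fls
  | Tru
  | Atom 'p "'q tm list"
  | Neg "('q, 'p) fm"
  | And "('q, 'p) fm" "('q, 'p) fm"
  | Or "('q, 'p) fm" "('q, 'p) fm"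
  | Imp "('q, 'p) fm" "('q, 'p) fm"
  | All nat "('q, 'p) fm"
  | Ex nat "('q, 'p) fm"

record ('a, 'q, 'p) struct =
  univ :: "'a set"
  const_e :: 'a
  fun_f :: "'q \<Rightarrow> 'a \<Rightarrow> 'a \<Rightarrow> 'a"
  rel :: "'p \<Rightarrow> 'a list \<Rightarrow> bool"

definition is_struct :: "'q set \<Rightarrow> ('a, 'q, 'p) struct \<Rightarrow> bool" where
  "is_struct Q M \<longleftrightarrow> univ M \<noteq> {} \<and> const_e M \<in> univ M \<and>
     (\<forall>q\<in>Q. \<forall>a\<in>univ M. \<forall>b\<in>univ M. fun_f M q a b \<in> univ M)"

primrec eval_tm :: "('a, 'q, 'p) struct \<Rightarrow> (nat \<Rightarrow> 'a) \<Rightarrow> 'q tm \<Rightarrow> 'a" where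
  "eval_tm M v (Var x) = v x"
| "eval_tm M v E = const_e M"
| "eval_tm M v (F q t1 t2) = fun_f M q (eval_tm M v t1) (eval_tm M v t2)"

primrec sat :: "('a, 'q, 'p) struct \<Rightarrow> (nat \<Rightarrow> 'a) \<Rightarrow> ('q, 'p) fm \<Rightarrow> bool" where
  "sat M v Fls \<longleftrightarrow> False"
| "sat M v Tru \<longleftrightarrow> True"
| "sat M v (Atom p ts) \<longleftrightarrow> rel M p (map (eval_tm M v) ts)"
| "sat M v (Neg \<phi>) \<longleftrightarrow> \<not> sat M v \<phi>"
| "sat M v (And \<phi> \<psi>) \<longleftrightarrow> sat M v \<phi> \<and> sat M v \<psi>"
| "sat M v (Or \<phi> \<psi>) \<longleftrightarrow> sat M v \<phi> \<or> sat M v \<psi>"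
| "sat M v (Imp \<phi> \<psi>) \<longleftrightarrow> (sat M v \<phi> \<longrightarrow> sat M v \<psi>)"
| "sat M v (All x \<phi>) \<longleftrightarrow> (\<forall>a\<in>univ M. sat M (v(x := a)) \<phi>)"
| "sat M v (Ex x \<phi>) \<longleftrightarrow> (\<exists>a\<in>univ M. sat M (v(x := a)) \<phi>)"

definition finite_model :: "'q set \<Rightarrow> ('a, 'q, 'p) struct \<Rightarrow> ('q, 'p) fm \<Rightarrow> bool" where
  "finite_model Q M \<phi> \<longleftrightarrow> is_struct Q M \<and> finite (univ M) \<and>
     (\<forall>v. range v \<subseteq> univ M \<longrightarrow> sat M v \<phi>)"

primrec fv_tm :: "'q tm \<Rightarrow> nat set" where
  "fv_tm (Var x) = {x}"
| "fv_tm E = {}"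
| "fv_tm (F q t1 t2) = fv_tm t1 \<union> fv_tm t2"

primrec fv :: "('q, 'p) fm \<Rightarrow> nat set" where
  "fv Fls = {}"
| "fv Tru = {}"
| "fv (Atom p ts) = (\<Union>t\<in>set ts. fv_tm t)"
| "fv (Neg \<phi>) = fv \<phi>"
| "fv (And \<phi> \<psi>) = fv \<phi> \<union> fv \<psi>"
| "fv (Or \<phi> \<psi>) = fv \<phi> \<union> fv \<psi>"
| "fv (Imp \<phi> \<psi>) = fv \<phi> \<union> fv \<psi>"
| "fv (All x \<phi>) = fv \<phi> - {x}"
| "fv (Ex x \<phi>) = fv \<phi> - {x}"

definition univ_closure :: "('q, 'p) fm \<Rightarrow> ('q, 'p) fm" where
  "univ_closure \<phi> = foldr All (sorted_list_of_set (fv \<phi>)) \<phi>"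

text \<open>
  Conjunction and disjunction over a finite set, along an arbitrary enumeration of it. On infinite
  sets \<open>enumeration\<close> is unspecified; all sets it is used for are finite.
\<close>

definition enumeration :: "'x set \<Rightarrow> 'x list" where
  "enumeration X = (SOME xs. set xs = X \<and> distinct xs)"

definition BigAnd :: "('q, 'p) fm set \<Rightarrow> ('q, 'p) fm" where
  "BigAnd \<Phi> = foldr And (enumeration \<Phi>) Tru"

definition BigOr :: "('x \<Rightarrow> ('q, 'p) fm) \<Rightarrow> 'x set \<Rightarrow> ('q, 'p) fm" where
  "BigOr \<phi> X = foldr Or (map \<phi> (enumeration X)) Fls"

lemma set_enumeration: "finite X \<Longrightarrow> set (enumeration X) = X"
  unfolding enumeration_def by (metis (mono_tags, lifting) finite_distinct_list someI_ex)

lemma sat_BigAnd: "finite \<Phi> \<Longrightarrow> sat M v (BigAnd \<Phi>) \<longleftrightarrow> (\<forall>\<phi>\<in>\<Phi>. sat M v \<phi>)"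
proof -
  have "sat M v (foldr And xs Tru) \<longleftrightarrow> (\<forall>\<phi>\<in>set xs. sat M v \<phi>)" for xs
    by (induction xs) auto
  then show "finite \<Phi> \<Longrightarrow> ?thesis"
    by (simp add: BigAnd_def set_enumeration)
qed

lemma sat_BigOr: "finite X \<Longrightarrow> sat M v (BigOr \<phi> X) \<longleftrightarrow> (\<exists>x\<in>X. sat M v (\<phi> x))"
proof -
  have "sat M v (foldr Or (map \<phi> xs) Fls) \<longleftrightarrow> (\<exists>x\<in>set xs. sat M v (\<phi> x))" for xs
    by (induction xs) auto
  then show "finite X \<Longrightarrow> ?thesis"
    by (simp add: BigOr_def set_enumeration)
qed


section \<open>The first-order translation\<close>

datatype ('i, 'u) psym = Reach | IState 'i | Init | UState 'u | Unsafe

definition Phi_R :: "'q set \<Rightarrow> ('q \<times> 'q) tree set \<Rightarrow> ('q, ('i, 'u) psym) fm set" where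
  "Phi_R Q R =
     {univ_closure (Atom Reach [gen [] \<rho>1, gen [] \<rho>2]) | r \<rho>1 \<rho>2.
        r \<in> R \<and> (\<rho>1, \<rho>2) \<in> rule_terms r} \<union>
     {univ_closure (Atom Reach [Var 0, Var 0])} \<union>
     {univ_closure (Imp (And (Atom Reach [Var 0, Var 1]) (Atom Reach [Var 1, Var 2]))
        (Atom Reach [Var 0, Var 2]))} \<union>
     {univ_closure (Imp (And (Atom Reach [Var 0, Var 1]) (Atom Reach [Var 2, Var 3]))
        (Atom Reach [F q (Var 0) (Var 2), F q (Var 1) (Var 3)])) | q. q \<in> Q}"

definition Phi_A ::
  "('q, 's) ta \<Rightarrow> ('s \<Rightarrow> ('i, 'u) psym) \<Rightarrow> ('i, 'u) psym \<Rightarrow> ('q, ('i, 'u) psym) fm set" where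
  "Phi_A A P Acc =
     {univ_closure (Atom (P \<theta>) [F q E E]) | q \<theta> \<theta>'.
        \<theta>' \<in> leaf_rules A \<and> (q, \<theta>', \<theta>', \<theta>) \<in> node_rules A} \<union>
     {univ_closure (Imp (And (Atom (P \<theta>1) [Var 0]) (Atom (P \<theta>2) [Var 1]))
        (Atom (P \<theta>3) [F q (Var 0) (Var 1)])) | q \<theta>1 \<theta>2 \<theta>3. (q, \<theta>1, \<theta>2, \<theta>3) \<in> node_rules A} \<union>
     {univ_closure (Imp (BigOr (\<lambda>\<theta>. Atom (P \<theta>) [Var 0]) (final A)) (Atom Acc [Var 0]))}"

definition Phi_I :: "('q, 'i) ta \<Rightarrow> ('q, ('i, 'u) psym) fm set" where
  "Phi_I A = Phi_A A IState Init"

definition Phi_U :: "('q, 'u) ta \<Rightarrow> ('q, ('i, 'u) psym) fm set" where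
  "Phi_U A = Phi_A A UState Unsafe"

definition safety_sentence ::
  "'q set \<Rightarrow> ('q \<times> 'q) tree set \<Rightarrow> ('q, 'i) ta \<Rightarrow> ('q, 'u) ta \<Rightarrow> ('q, ('i, 'u) psym) fm" where
  "safety_sentence Q R A\<^sub>I A\<^sub>U =
     And (BigAnd (Phi_R Q R)) (And (BigAnd (Phi_I A\<^sub>I)) (And (BigAnd (Phi_U A\<^sub>U))
       (Neg (Ex 0 (Ex 1 (And (Atom Init [Var 0]) (And (Atom Unsafe [Var 1])
          (Atom Reach [Var 0, Var 1]))))))))"

lemma finite_rule_terms: "finite (rule_terms \<tau>)"
proof (induction \<tau> rule: rule_terms.induct)
  case (1 \<tau>)
  let ?q1 = "fst (the (\<tau> []))" and ?q2 = "snd (the (\<tau> []))"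
  let ?A = "rule_terms (subtree \<tau> False)" and ?B = "rule_terms (subtree \<tau> True)"
  have two: "{(F ?q1 \<rho>1 \<rho>2, F ?q2 \<rho>3 \<rho>4) | \<rho>1 \<rho>2 \<rho>3 \<rho>4. (\<rho>1, \<rho>3) \<in> ?A \<and> (\<rho>2, \<rho>4) \<in> ?B} =
      (\<lambda>((\<rho>1, \<rho>3), (\<rho>2, \<rho>4)). (F ?q1 \<rho>1 \<rho>2, F ?q2 \<rho>3 \<rho>4)) ` (?A \<times> ?B)"
    by force
  have left: "{(F ?q1 \<rho>1 E, F ?q2 \<rho>2 E) | \<rho>1 \<rho>2. (\<rho>1, \<rho>2) \<in> ?A} =
      (\<lambda>(\<rho>1, \<rho>2). (F ?q1 \<rho>1 E, F ?q2 \<rho>2 E)) ` ?A"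
    by force
  have right: "{(F ?q1 E \<rho>1, F ?q2 E \<rho>2) | \<rho>1 \<rho>2. (\<rho>1, \<rho>2) \<in> ?A} =
      (\<lambda>(\<rho>1, \<rho>2). (F ?q1 E \<rho>1, F ?q2 E \<rho>2)) ` ?A"
    by force
  show ?case
    using 1 by (subst rule_terms.simps) (auto simp: Let_def two left right)
qed

lemma finite_Phi_R:
  assumes "parameterized_tree_system Q R"
  shows "finite (Phi_R Q R :: ('q, ('i, 'u) psym) fm set)"
proof -
  have "{univ_closure (Atom (Reach :: ('i, 'u) psym) [gen [] \<rho>1, gen [] \<rho>2]) | r \<rho>1 \<rho>2.
        r \<in> R \<and> (\<rho>1, \<rho>2) \<in> rule_terms r} =
      (\<lambda>(\<rho>1, \<rho>2). univ_closure (Atom Reach [gen [] \<rho>1, gen [] \<rho>2])) ` (\<Union>r\<in>R. rule_terms r)"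
    by force
  then show ?thesis
    using assms by (simp add: Phi_R_def parameterized_tree_system_def finite_rule_terms)
qed

lemma finite_Phi_A:
  assumes "finite Q" "tree_automaton Q A"
  shows "finite (Phi_A A P Acc)"
proof -
  have fin: "finite (node_rules A)"
    using assms unfolding tree_automaton_def
    by (meson finite_SigmaI finite_subset)
  have "{univ_closure (Atom (P \<theta>) [F q E E]) | q \<theta> \<theta>'.
        \<theta>' \<in> leaf_rules A \<and> (q, \<theta>', \<theta>', \<theta>) \<in> node_rules A} \<subseteq>
      (\<lambda>(q, \<theta>1, \<theta>2, \<theta>). univ_closure (Atom (P \<theta>) [F q E E])) ` node_rules A"
    by force
  moreover have "{univ_closure (Imp (And (Atom (P \<theta>1) [Var 0]) (Atom (P \<theta>2) [Var 1]))
        (Atom (P \<theta>3) [F q (Var 0) (Var 1)])) | q \<theta>1 \<theta>2 \<theta>3. (q, \<theta>1, \<theta>2, \<theta>3) \<in> node_rules A} \<subseteq>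
      (\<lambda>(q, \<theta>1, \<theta>2, \<theta>3). univ_closure (Imp (And (Atom (P \<theta>1) [Var 0]) (Atom (P \<theta>2) [Var 1]))
        (Atom (P \<theta>3) [F q (Var 0) (Var 1)]))) ` node_rules A"
    by force
  ultimately show ?thesis
    unfolding Phi_A_def using fin
    by (meson finite.emptyI finite.insertI finite_UnI finite_imageI finite_subset)
qed

end

theory Submission
  imports Defs
begin

text \<open>
  Trees are identified with ground terms. The sets \<open>U\<^sub>i\<close> are all saturated by congruences of finite
  index: this holds for the language of an automaton and is preserved by one-step predecessors
  (record the classes of all one-step successors of a term) and by upward closure (record the
  classes of all terms embedded into a term). Hence no well-quasi-order argument is needed.

  For \<open>V = U\<^sub>n\<close>, take the quotient of the term algebra by such a congruence, and let \<open>Reach(a, b)\<close>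
  hold iff \<open>C[b] \<in> V\<close> implies \<open>C[a] \<in> V\<close> for all contexts \<open>C\<close>. This is a preorder compatible
  with the \<open>f\<^sub>q\<close>; it contains the rules because \<open>V\<close> is closed under predecessors, and it relates no
  initial to an unsafe term because \<open>V\<close> contains the unsafe and excludes the initial ones. The
  automaton predicates are the images of the runs on complete terms.
\<close>

section \<open>Ground terms as partial maps\<close>

text \<open>The variables of the sentences range over the whole universe, which contains the value
  of \<open>e\<close>; incomplete terms such as \<open>f_q(e, t)\<close> therefore need values, and
  rules are instantiated with them as well. Hence congruences, contexts and rewriting live on all
  ground terms, while \<open>V\<close> contains complete terms only. This fits together because
  rewriting preserves completeness in both directions, so that \<open>V\<close> is closed under
  predecessors among all ground terms. The relation "\<open>b\<close> in \<open>V\<close> implies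
  \<open>a\<close> in \<open>V\<close>" already is a preorder containing the rewrite steps; it
  merely fails to be compatible with the \<open>f_q\<close>. Quantifying over contexts yields the
  largest compatible preorder inside it. Embeddings matter only for the recognizability of the sets
  \<open>U i\<close>. The model itself uses exact predecessors, which lie in \<open>Pre\<close>
  because \<open>\<preceq>\<close> is reflexive. The hypothesis \<open>U (Suc n) = U n\<close> is
  what makes \<open>V\<close> closed.\<close>

inductive_set gterms :: "'q set \<Rightarrow> 'q tm set" for Q where
  E: "E \<in> gterms Q"
| F: "q \<in> Q \<Longrightarrow> t1 \<in> gterms Q \<Longrightarrow> t2 \<in> gterms Q \<Longrightarrow> F q t1 t2 \<in> gterms Q"

text \<open>These are the terms \<open>tree_term \<tau>\<close> of complete trees. Since
  \<open>e\<close> is no tree, a node has either two \<open>e\<close> below it or two complete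
  terms.\<close>

inductive_set cterms :: "'q set \<Rightarrow> 'q tm set" for Q where
  leaf: "q \<in> Q \<Longrightarrow> F q E E \<in> cterms Q"
| node: "q \<in> Q \<Longrightarrow> t1 \<in> cterms Q \<Longrightarrow> t2 \<in> cterms Q \<Longrightarrow> F q t1 t2 \<in> cterms Q"

lemma F_in_gterms_iff [simp]:
  "F q t1 t2 \<in> gterms Q \<longleftrightarrow> q \<in> Q \<and> t1 \<in> gterms Q \<and> t2 \<in> gterms Q"
  by (auto elim: gterms.cases intro: gterms.intros)

declare gterms.E [simp]

lemma E_notin_cterms [simp]: "E \<notin> cterms Q"
  by (auto elim: cterms.cases)

lemma F_in_cterms_iff:
  "F q t1 t2 \<in> cterms Q \<longleftrightarrow>
     q \<in> Q \<and> (t1 = E \<and> t2 = E \<or> t1 \<in> cterms Q \<and> t2 \<in> cterms Q)"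
  by (auto elim: cterms.cases intro: cterms.intros)

lemma cterms_subset_gterms: "t \<in> cterms Q \<Longrightarrow> t \<in> gterms Q"
  by (induction rule: cterms.induct) auto

definition node :: "'q \<Rightarrow> 'q tree \<Rightarrow> 'q tree \<Rightarrow> 'q tree" where
  "node q \<tau>1 \<tau>2 = (\<lambda>s. case s of [] \<Rightarrow> Some q | b # s' \<Rightarrow> (if b then \<tau>2 else \<tau>1) s')"

lemma node_simps [simp]:
  "node q \<tau>1 \<tau>2 [] = Some q"
  "node q \<tau>1 \<tau>2 (b # s) = (if b then \<tau>2 else \<tau>1) s"
  "subtree (node q \<tau>1 \<tau>2) b = (if b then \<tau>2 else \<tau>1)"
  by (auto simp: node_def subtree_def)

lemma node_eqI:
  assumes "\<tau> [] = Some q" "subtree \<tau> False = \<tau>1" "subtree \<tau> True = \<tau>2"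
  shows "\<tau> = node q \<tau>1 \<tau>2"
proof
  fix s show "\<tau> s = node q \<tau>1 \<tau>2 s"
    using assms by (cases s) (auto simp: subtree_def)
qed

text \<open>The constant \<open>e\<close> is the empty map; this makes every ground term, complete or not, a partial map.\<close>

primrec of_term :: "'q tm \<Rightarrow> 'q tree" where
  "of_term (Var x) = Map.empty"
| "of_term E = Map.empty"
| "of_term (F q t1 t2) = node q (of_term t1) (of_term t2)"

text \<open>The part of \<open>is_tree\<close> that survives for incomplete terms:
  \<open>of_term (F q E t)\<close> can have a right child without a left one.\<close>

definition prefix_closed :: "'q tree \<Rightarrow> bool" where
  "prefix_closed \<tau> \<longleftrightarrow> (\<forall>s u. s @ u \<in> dom \<tau> \<longrightarrow> s \<in> dom \<tau>)"

lemma prefix_closedD: "prefix_closed \<tau> \<Longrightarrow> s @ u \<in> dom \<tau> \<Longrightarrow> s \<in> dom \<tau>"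
  by (auto simp: prefix_closed_def)

lemma prefix_closed_of_term: "prefix_closed (of_term t)"
proof (induction t)
  case (F q t1 t2)
  show ?case unfolding prefix_closed_def
  proof (intro allI impI)
    fix s u assume "s @ u \<in> dom (of_term (F q t1 t2))"
    then show "s \<in> dom (of_term (F q t1 t2))"
      using F by (cases s) (fastforce simp: prefix_closed_def split: if_splits)+
  qed
qed (auto simp: prefix_closed_def)

lemma is_tree_prefix_closed: "is_tree Q \<tau> \<Longrightarrow> prefix_closed \<tau>"
  unfolding is_tree_def prefix_closed_def by (meson prefixI)

lemma is_tree_root: "is_tree Q \<tau> \<Longrightarrow> [] \<in> dom \<tau>"
  unfolding is_tree_def by (meson Nil_prefix all_not_in_conv)

lemma is_tree_subtree:
  assumes "is_tree Q \<tau>" "[b] \<in> dom \<tau>"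
  shows "is_tree Q (subtree \<tau> b)"
proof -
  let ?D = "dom \<tau>"
  have dom: "dom (subtree \<tau> b) = (#) b -` ?D"
    by (auto simp: subtree_def)
  have "finite ((#) b -` dom \<tau>)"
    using assms by (intro finite_vimageI) (auto simp: is_tree_def)
  moreover have "ran (subtree \<tau> b) \<subseteq> ran \<tau>"
    by (auto simp: subtree_def ran_def)
  moreover have "p \<in> (#) b -` ?D" if "s \<in> (#) b -` ?D" "prefix p s" for s p
  proof -
    have "prefix (b # p) (b # s)" "b # s \<in> ?D" using that by auto
    then show ?thesis using assms(1) unfolding is_tree_def by blast
  qed
  moreover have "s @ [False] \<in> (#) b -` ?D" if "s @ [True] \<in> (#) b -` ?D" for s
  proof -
    have "(b # s) @ [True] \<in> ?D" using that by simp
    then have "(b # s) @ [False] \<in> ?D" using assms(1) unfolding is_tree_def by blast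
    then show ?thesis by simp
  qed
  moreover have "[] \<in> (#) b -` ?D" using assms(2) by simp
  ultimately show ?thesis
    using assms(1) unfolding is_tree_def dom by blast
qed

lemma complete_tree_subtree:
  assumes "complete_tree Q \<tau>" "[b] \<in> dom \<tau>"
  shows "complete_tree Q (subtree \<tau> b)"
proof -
  have "s \<in> dom (subtree \<tau> b) \<longleftrightarrow> b # s \<in> dom \<tau>" for s
    by (auto simp: subtree_def)
  then show ?thesis
    using assms is_tree_subtree unfolding complete_tree_def by (metis append_Cons)
qed

text \<open>Together with \<open>of_term_complete\<close> this makes \<open>tree_term\<close> and
  \<open>of_term\<close> mutually inverse bijections between complete trees and
  \<open>cterms Q\<close>.\<close>

lemma tree_term_complete:
  "complete_tree Q \<tau> \<Longrightarrow> tree_term \<tau> \<in> cterms Q \<and> of_term (tree_term \<tau>) = \<tau>"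
proof (induction \<tau> rule: tree_term.induct)
  case (1 \<tau>)
  then have tree: "is_tree Q \<tau>" by (simp add: complete_tree_def)
  then have fin: "finite (dom \<tau>) \<and> [] \<in> dom \<tau>"
    using is_tree_root by (auto simp: is_tree_def)
  then obtain q where q: "\<tau> [] = Some q" by auto
  have "q \<in> Q"
    using tree q unfolding is_tree_def ran_def by blast
  show ?case
  proof (cases "[False] \<in> dom \<tau>")
    case True
    then have "[True] \<in> dom \<tau>"
      using 1(3) fin unfolding complete_tree_def by (metis append_Nil)
    then show ?thesis
      using 1 fin True q \<open>q \<in> Q\<close> complete_tree_subtree[OF 1(3)]
      by (auto simp: tree_term.simps[of \<tau>] F_in_cterms_iff intro!: node_eqI[symmetric])
  next
    case False
    then have "subtree \<tau> b = Map.empty" for b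
    proof -
      have "[b] \<notin> dom \<tau>"
        using 1(3) fin False unfolding complete_tree_def by (metis (full_types) append_Nil)
      then show ?thesis
        using prefix_closedD[OF is_tree_prefix_closed[OF tree], of "[b]"]
        by (fastforce simp: subtree_def)
    qed
    then show ?thesis
      using fin False q \<open>q \<in> Q\<close>
      by (auto simp: tree_term.simps[of \<tau>] F_in_cterms_iff intro!: node_eqI[symmetric])
  qed
qed

lemma dom_node: "dom (node q \<tau>1 \<tau>2) = insert [] ((#) False ` dom \<tau>1 \<union> (#) True ` dom \<tau>2)"
proof (rule set_eqI)
  fix s show "s \<in> dom (node q \<tau>1 \<tau>2) \<longleftrightarrow> s \<in> insert [] ((#) False ` dom \<tau>1 \<union> (#) True ` dom \<tau>2)"
    by (cases s) (auto simp: image_iff split: if_splits)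
qed

lemma finite_dom_of_term: "finite (dom (of_term t))"
  by (induction t) (auto simp: dom_node)

lemma of_term_complete:
  "t \<in> cterms Q \<Longrightarrow> complete_tree Q (of_term t) \<and> tree_term (of_term t) = t"
proof (induction rule: cterms.induct)
  case (leaf q)
  have dom: "dom (node q Map.empty Map.empty) = {[]}"
    by (auto simp: dom_node)
  have "ran (node q Map.empty Map.empty) \<subseteq> {q}"
  proof
    fix x assume "x \<in> ran (node q Map.empty Map.empty)"
    then obtain s where "node q Map.empty Map.empty s = Some x" by (auto simp: ran_def)
    then show "x \<in> {q}" by (cases s) (auto split: if_splits)
  qed
  then show ?case
    using leaf dom
    by (auto simp: complete_tree_def is_tree_def tree_term.simps[of "node q _ _"])
next
  case (node q t1 t2)
  let ?t = "F q t1 t2"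
  have dom: "b # s \<in> dom (of_term ?t) \<longleftrightarrow> s \<in> dom (of_term (if b then t2 else t1))" for b s
    by auto
  have root: "[] \<in> dom (of_term ?t)" "[] \<in> dom (of_term t1)" "[] \<in> dom (of_term t2)"
    using node.IH is_tree_root unfolding complete_tree_def by auto
  have ran: "ran (of_term ?t) \<subseteq> Q"
  proof
    fix x assume "x \<in> ran (of_term ?t)"
    then obtain s where "of_term ?t s = Some x" by (auto simp: ran_def)
    then show "x \<in> Q"
      using node unfolding complete_tree_def is_tree_def ran_def
      by (cases s) (auto split: if_splits)
  qed
  have sib: "s @ [False] \<in> dom (of_term ?t) \<longleftrightarrow> s @ [True] \<in> dom (of_term ?t)" for s
  proof (cases s)
    case Nil
    then show ?thesis using root by auto
  next
    case (Cons b u)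
    have "complete_tree Q (of_term (if b then t2 else t1))"
      using node.IH by simp
    \<comment> \<open>Completeness compares siblings only below an existing node; prefix closure
      supplies that parent from either sibling.\<close>
    then have "u @ [False] \<in> dom (of_term (if b then t2 else t1)) \<longleftrightarrow>
        u @ [True] \<in> dom (of_term (if b then t2 else t1))"
      using prefix_closedD[OF prefix_closed_of_term] unfolding complete_tree_def by meson
    then show ?thesis using Cons dom by simp
  qed
  have "p \<in> dom (of_term ?t)" if "s \<in> dom (of_term ?t)" "prefix p s" for s p
    using that prefix_closedD[OF prefix_closed_of_term, of p _ ?t] by (metis prefixE)
  then have "is_tree Q (of_term ?t)"
    unfolding is_tree_def
    using finite_dom_of_term[of ?t] root(1) ran sib by blast
  then show ?case
    using sib root node.IH finite_dom_of_term[of ?t]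
    by (auto simp: complete_tree_def tree_term.simps[of "node q _ _"])
qed

section \<open>Embeddings of terms\<close>

lemma embedding_prefix:
  assumes "embedding f \<sigma> \<tau>" "prefix_closed \<sigma>" "s @ u \<in> dom \<sigma>"
  shows "prefix (f s) (f (s @ u))"
  using assms(3)
proof (induction u rule: rev_induct)
  case (snoc b u)
  then have "prefix (f s) (f (s @ u))"
    using prefix_closedD[OF assms(2), of "s @ u"] by simp
  moreover have "prefix (f (s @ u) @ [b]) (f ((s @ u) @ [b]))"
    using assms(1) snoc.prems unfolding embedding_def by (metis append.assoc)
  ultimately show ?case
    by (metis append.assoc append_prefixD prefix_order.trans)
qed simp

text \<open>All images start with \<open>b\<close>, so removing this letter loses nothing. The
  position \<open>c\<close> is \<open>[]\<close> when the whole of \<open>\<sigma>\<close> is mapped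
  below child \<open>b\<close>, and \<open>[b]\<close> when a child of the root is mapped into the
  child on the same side.\<close>

lemma embedding_child:
  assumes f: "embedding f \<sigma> \<tau>" and pc: "prefix_closed \<sigma>"
    and pre: "\<And>s. c @ s \<in> dom \<sigma> \<Longrightarrow> prefix [b] (f (c @ s))"
  shows "(\<lambda>s. \<sigma> (c @ s)) \<preceq> subtree \<tau> b"
proof -
  define g where "g s = tl (f (c @ s))" for s
  have fg: "f (c @ s) = b # g s" if "c @ s \<in> dom \<sigma>" for s
    using pre[OF that] by (auto simp: g_def prefix_def)
  have "embedding g (\<lambda>s. \<sigma> (c @ s)) (subtree \<tau> b)"
    unfolding embedding_def
  proof (intro conjI ballI allI impI)
    show "inj_on g (dom (\<lambda>s. \<sigma> (c @ s)))"
    proof (rule inj_onI)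
      fix s u assume "s \<in> dom (\<lambda>s. \<sigma> (c @ s))" "u \<in> dom (\<lambda>s. \<sigma> (c @ s))" "g s = g u"
      then have "c @ s \<in> dom \<sigma>" "c @ u \<in> dom \<sigma>" "f (c @ s) = f (c @ u)"
        using fg by (auto simp: domIff)
      then show "s = u"
        using f unfolding embedding_def inj_on_def by blast
    qed
  next
    have "subtree \<tau> b (g s) = \<sigma> (c @ s)" if "c @ s \<in> dom \<sigma>" for s
      using f fg[OF that] that unfolding embedding_def subtree_def by metis
    then show "g ` dom (\<lambda>s. \<sigma> (c @ s)) \<subseteq> dom (subtree \<tau> b)"
      and "\<And>s. s \<in> dom (\<lambda>s. \<sigma> (c @ s)) \<Longrightarrow> subtree \<tau> b (g s) = \<sigma> (c @ s)"
      by (auto simp: dom_def)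
  next
    fix s d assume "s @ [d] \<in> dom (\<lambda>s. \<sigma> (c @ s))"
    then have d: "c @ s @ [d] \<in> dom \<sigma>" by auto
    then have "c @ s \<in> dom \<sigma>"
      using prefix_closedD[OF pc, of "c @ s"] by simp
    moreover have "prefix (f (c @ s) @ [d]) (f (c @ s @ [d]))"
      using f d unfolding embedding_def by (metis append.assoc)
    ultimately show "prefix (g s @ [d]) (g (s @ [d]))"
      using fg[of s] fg[of "s @ [d]"] d by simp
  qed
  then show ?thesis by (auto simp: embeds_def)
qed

lemma embeds_subtree:
  assumes "\<sigma> \<preceq> subtree \<tau> b"
  shows "\<sigma> \<preceq> \<tau>"
proof -
  obtain f where f: "embedding f \<sigma> (subtree \<tau> b)"
    using assms by (auto simp: embeds_def)
  have "embedding (\<lambda>s. b # f s) \<sigma> \<tau>"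
    using f unfolding embedding_def inj_on_def subtree_def dom_def by auto
  then show ?thesis by (auto simp: embeds_def)
qed

lemma embeds_node:
  assumes "\<sigma>1 \<preceq> \<tau>1" "\<sigma>2 \<preceq> \<tau>2"
  shows "node q \<sigma>1 \<sigma>2 \<preceq> node q \<tau>1 \<tau>2"
proof -
  obtain f1 f2 where f: "embedding f1 \<sigma>1 \<tau>1" "embedding f2 \<sigma>2 \<tau>2"
    using assms by (auto simp: embeds_def)
  define f where "f s = (case s of [] \<Rightarrow> [] | b # u \<Rightarrow> b # (if b then f2 else f1) u)" for s
  have f_simps: "f [] = []" "f (b # u) = b # (if b then f2 else f1) u" for b u
    by (auto simp: f_def)
  have lab: "node q \<tau>1 \<tau>2 (f s) = node q \<sigma>1 \<sigma>2 s" if "s \<in> dom (node q \<sigma>1 \<sigma>2)" for s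
    using f that by (cases s) (auto simp: f_simps embedding_def split: if_splits)
  have "embedding f (node q \<sigma>1 \<sigma>2) (node q \<tau>1 \<tau>2)"
    unfolding embedding_def
  proof (intro conjI ballI allI impI)
    show "inj_on f (dom (node q \<sigma>1 \<sigma>2))"
    proof (rule inj_onI)
      fix s u assume *: "s \<in> dom (node q \<sigma>1 \<sigma>2)" "u \<in> dom (node q \<sigma>1 \<sigma>2)" "f s = f u"
      have "inj_on f1 (dom \<sigma>1)" "inj_on f2 (dom \<sigma>2)"
        using f by (auto simp: embedding_def)
      then show "s = u"
        using * by (cases s; cases u) (auto simp: f_simps dest: inj_onD split: if_splits)
    qed
    show "f ` dom (node q \<sigma>1 \<sigma>2) \<subseteq> dom (node q \<tau>1 \<tau>2)"
      using lab by (auto simp: dom_def)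
  next
    fix s b assume *: "s @ [b] \<in> dom (node q \<sigma>1 \<sigma>2)"
    show "prefix (f s @ [b]) (f (s @ [b]))"
      using f * by (cases s) (auto simp: f_simps embedding_def domIff split: if_splits)
  qed (use lab in auto)
  then show ?thesis by (auto simp: embeds_def)
qed

lemma embeds_refl: "\<tau> \<preceq> \<tau>"
  unfolding embeds_def embedding_def by (rule exI[of _ id]) auto

text \<open>Case distinction on the image of the root: inside one of the two children, or the root
  itself, in which case the labels agree and left and right are respected. This recursion lets the
  terms embedded into \<open>F q t1 t2\<close> be computed from those embedded into
  \<open>t1\<close> and \<open>t2\<close>.\<close>

lemma embeds_F_iff:
  "of_term s \<preceq> of_term (F q t1 t2) \<longleftrightarrow>
     of_term s \<preceq> of_term t1 \<or> of_term s \<preceq> of_term t2 \<or>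
     (\<exists>s1 s2. s = F q s1 s2 \<and> of_term s1 \<preceq> of_term t1 \<and> of_term s2 \<preceq> of_term t2)"
  (is "?L \<longleftrightarrow> ?R")
proof
  let ?\<sigma> = "of_term s" and ?\<tau> = "of_term (F q t1 t2)"
  have pc: "prefix_closed ?\<sigma>" by (rule prefix_closed_of_term)
  assume ?L
  then obtain f where f: "embedding f ?\<sigma> ?\<tau>" by (auto simp: embeds_def)
  show ?R
  proof (cases "f []")
    case (Cons b p)
    have "prefix [b] (f ([] @ u))" if "[] @ u \<in> dom ?\<sigma>" for u
      using embedding_prefix[OF f pc that] Cons by (auto simp: prefix_def)
    then have "(\<lambda>u. ?\<sigma> ([] @ u)) \<preceq> subtree ?\<tau> b"
      by (rule embedding_child[OF f pc])
    then show ?thesis by (cases b) simp_all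
  next
    case Nil
    show ?thesis
    proof (cases s)
      case (F q' s1 s2)
      have "q' = q"
      proof -
        have "?\<tau> (f []) = ?\<sigma> []"
          using f F unfolding embedding_def by (simp add: domIff)
        then show ?thesis using Nil F by simp
      qed
      moreover have "(if b then of_term s2 else of_term s1) \<preceq> (if b then of_term t2 else of_term t1)"
        for b
      proof -
        have "prefix [b] (f ([b] @ u))" if u: "[b] @ u \<in> dom ?\<sigma>" for u
        proof -
          have "[] @ [b] \<in> dom ?\<sigma>"
            using prefix_closedD[OF pc u] by simp
          then have "prefix (f [] @ [b]) (f [b])"
            using f unfolding embedding_def by (metis append_Nil)
          then have "prefix [b] (f [b])" using Nil by simp
          then show ?thesis
            using embedding_prefix[OF f pc u] by (rule prefix_order.trans)
        qed
        then have "(\<lambda>u. ?\<sigma> ([b] @ u)) \<preceq> subtree ?\<tau> b"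
          by (rule embedding_child[OF f pc])
        then show ?thesis by (simp add: F split: if_splits)
      qed
      from this[of False] this[of True] have "of_term s1 \<preceq> of_term t1" "of_term s2 \<preceq> of_term t2"
        by simp_all
      ultimately show ?thesis using F by blast
    \<comment> \<open>Otherwise \<open>of_term s\<close> is the empty map, which embeds into
      \<open>of_term t1\<close>.\<close>
    qed (auto simp: embeds_def embedding_def)
  qed
next
  assume ?R
  then show ?L
    using embeds_subtree[of "of_term s" "of_term (F q t1 t2)" False]
      embeds_subtree[of "of_term s" "of_term (F q t1 t2)" True]
      embeds_node[of _ "of_term t1" _ "of_term t2" q]
    by auto
qed

section \<open>Rewriting of terms\<close>

text \<open>
  \<open>inst \<rho>1 \<rho>2 t t'\<close>: the pair \<open>(t, t')\<close> is an instance of \<open>(\<rho>1\<^sup>g\<^sup>e\<^sup>n, \<rho>2\<^sup>g\<^sup>e\<^sup>n)\<close>.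
\<close>

inductive inst :: "'q tm \<Rightarrow> 'q tm \<Rightarrow> 'q tm \<Rightarrow> 'q tm \<Rightarrow> bool" where
  E: "inst E E t t"
| F: "inst \<rho>1 \<rho>3 t1 t3 \<Longrightarrow> inst \<rho>2 \<rho>4 t2 t4 \<Longrightarrow>
      inst (F q \<rho>1 \<rho>2) (F q' \<rho>3 \<rho>4) (F q t1 t2) (F q' t3 t4)"

inductive tstep :: "('q tm \<times> 'q tm) set \<Rightarrow> 'q tm \<Rightarrow> 'q tm \<Rightarrow> bool" for P where
  root: "(\<rho>1, \<rho>2) \<in> P \<Longrightarrow> inst \<rho>1 \<rho>2 t t' \<Longrightarrow> tstep P t t'"
| left: "tstep P t1 t1' \<Longrightarrow> tstep P (F q t1 t2) (F q t1' t2)"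
| right: "tstep P t2 t2' \<Longrightarrow> tstep P (F q t1 t2) (F q t1 t2')"

text \<open>Occurrence and relabelling in one local condition, almost symmetric in
  \<open>\<tau>\<close> and \<open>\<tau>'\<close>, that can be restricted to subtrees. That images
  are positions of \<open>\<tau>\<close> is contained in the label equation;
  \<open>s @ [True] \<in> dom r\<close> says that \<open>s\<close> has two children, since a right
  child forces a left one.\<close>

definition relabels :: "(pos \<Rightarrow> pos) \<Rightarrow> ('q \<times> 'q) tree \<Rightarrow> 'q tree \<Rightarrow> 'q tree \<Rightarrow> bool" where
  "relabels \<phi> r \<tau> \<tau>' \<longleftrightarrow>
     (\<forall>s\<in>dom r. \<tau> (\<phi> s) = map_option fst (r s) \<and> \<tau>' (\<phi> s) = map_option snd (r s)) \<and>
     (\<forall>s c. s @ [c] \<in> dom r \<longrightarrow> (\<exists>b. \<phi> (s @ [c]) = \<phi> s @ [b]) \<and>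
        (s @ [True] \<in> dom r \<longrightarrow> \<phi> (s @ [c]) = \<phi> s @ [c])) \<and>
     (\<forall>p. p \<notin> \<phi> ` dom r \<longrightarrow> \<tau>' p = \<tau> p)"

lemma step_iff_relabels:
  assumes "\<forall>r\<in>R. is_tree (Q \<times> Q) r"
  shows "step Q R \<tau> \<tau>' \<longleftrightarrow> complete_tree Q \<tau> \<and> (\<exists>r\<in>R. \<exists>\<phi>. relabels \<phi> r \<tau> \<tau>')"
proof -
  have "relabels \<phi> r \<tau> \<tau>' \<longleftrightarrow> occurrence \<phi> r \<tau> \<and>
        (\<forall>s\<in>dom r. \<tau>' (\<phi> s) = map_option snd (r s)) \<and>
        (\<forall>p. p \<notin> \<phi> ` dom r \<longrightarrow> \<tau>' p = \<tau> p)" if "r \<in> R" for r \<phi>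
  proof -
    have tree: "is_tree (Q \<times> Q) r" using assms that by blast
    have pc: "s \<in> dom r" if "s @ [c] \<in> dom r" for s c
      using prefix_closedD[OF is_tree_prefix_closed[OF tree] that] .
    have sib: "s @ [False] \<in> dom r" if "s @ [True] \<in> dom r" for s
      using tree that by (simp add: is_tree_def)
    show ?thesis
    proof
      assume rel: "relabels \<phi> r \<tau> \<tau>'"
      have lab: "\<phi> s \<in> dom \<tau>" if "s \<in> dom r" for s
        using rel that unfolding relabels_def dom_def by auto
      have child: "\<phi> (s @ [c]) \<in> {\<phi> s @ [False], \<phi> s @ [True]}" if "s @ [c] \<in> dom r" for s c
        using rel that unfolding relabels_def by (metis (full_types) insertCI)
      have both: "\<phi> (s @ [c]) = \<phi> s @ [c]" if "s @ [c] \<in> dom r" "s @ [True] \<in> dom r" for s c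
        using rel that unfolding relabels_def by blast
      have "occurrence \<phi> r \<tau>"
        unfolding occurrence_def
        using lab child both rel unfolding relabels_def by blast
      then show "occurrence \<phi> r \<tau> \<and> (\<forall>s\<in>dom r. \<tau>' (\<phi> s) = map_option snd (r s)) \<and>
        (\<forall>p. p \<notin> \<phi> ` dom r \<longrightarrow> \<tau>' p = \<tau> p)"
        using rel unfolding relabels_def by blast
    next
      assume occ: "occurrence \<phi> r \<tau> \<and> (\<forall>s\<in>dom r. \<tau>' (\<phi> s) = map_option snd (r s)) \<and>
        (\<forall>p. p \<notin> \<phi> ` dom r \<longrightarrow> \<tau>' p = \<tau> p)"
      have "(\<exists>b. \<phi> (s @ [c]) = \<phi> s @ [b]) \<and> (s @ [True] \<in> dom r \<longrightarrow> \<phi> (s @ [c]) = \<phi> s @ [c])"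
        if sc: "s @ [c] \<in> dom r" for s c
      proof (cases "s @ [True] \<in> dom r")
        case True
        then show ?thesis
          using occ pc[OF sc] sib[OF True] unfolding occurrence_def by (cases c) auto
      next
        case False
        then have "c = False" using sc by (cases c) auto
        then show ?thesis
          using occ pc[OF sc] sc False unfolding occurrence_def by blast
      qed
      then show "relabels \<phi> r \<tau> \<tau>'"
        using occ unfolding relabels_def occurrence_def by blast
    qed
  qed
  then show ?thesis unfolding step_def by blast
qed

lemma relabels_prefix:
  assumes "relabels \<phi> r \<tau> \<tau>'" "prefix_closed r" "s @ u \<in> dom r"
  shows "prefix (\<phi> s) (\<phi> (s @ u))"
  using assms(3)
proof (induction u rule: rev_induct)
  case (snoc b u)
  then have "prefix (\<phi> s) (\<phi> (s @ u))"
    using prefix_closedD[OF assms(2), of "s @ u"] by simp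
  moreover have "\<exists>d. \<phi> ((s @ u) @ [b]) = \<phi> (s @ u) @ [d]"
    using assms(1) snoc.prems unfolding relabels_def by (metis append.assoc)
  ultimately show ?case
    by (metis append.assoc prefix_prefix)
qed simp

text \<open>The counterpart of \<open>embedding_child\<close>. The assumption \<open>only\<close> is
  there for the frame condition: every position changed inside branch \<open>b\<close> must come
  from the part of the rule below \<open>c\<close>.\<close>

lemma relabels_child:
  assumes rel: "relabels \<phi> r \<tau> \<tau>'"
    and pc: "prefix_closed r"
    and pre: "\<And>s. c @ s \<in> dom r \<Longrightarrow> prefix [b] (\<phi> (c @ s))"
    and only: "\<And>s. s \<in> dom r \<Longrightarrow> prefix [b] (\<phi> s) \<Longrightarrow> prefix c s"
  shows "relabels (\<lambda>s. tl (\<phi> (c @ s))) (\<lambda>s. r (c @ s)) (subtree \<tau> b) (subtree \<tau>' b)"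
proof -
  define g where "g s = tl (\<phi> (c @ s))" for s
  have g: "\<phi> (c @ s) = b # g s" if "c @ s \<in> dom r" for s
    using pre[OF that] by (auto simp: g_def prefix_def)
  have "relabels g (\<lambda>s. r (c @ s)) (subtree \<tau> b) (subtree \<tau>' b)"
    unfolding relabels_def
  proof (intro conjI ballI allI impI)
    fix s assume "s \<in> dom (\<lambda>s. r (c @ s))"
    then have s: "c @ s \<in> dom r" by auto
    have "\<tau> (b # g s) = map_option fst (r (c @ s))" "\<tau>' (b # g s) = map_option snd (r (c @ s))"
      using rel s g[OF s] unfolding relabels_def by metis+
    then show "subtree \<tau> b (g s) = map_option fst (r (c @ s))"
      "subtree \<tau>' b (g s) = map_option snd (r (c @ s))"
      by (auto simp: subtree_def)
  next
    fix s d assume "s @ [d] \<in> dom (\<lambda>s. r (c @ s))"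
    then have d: "(c @ s) @ [d] \<in> dom r" by auto
    then have s: "c @ s \<in> dom r" using prefix_closedD[OF pc] by blast
    have *: "\<phi> (c @ s) = b # g s" "\<phi> ((c @ s) @ [d]) = b # g (s @ [d])"
      using g[OF s] g[of "s @ [d]"] d by auto
    show "\<exists>e. g (s @ [d]) = g s @ [e]"
      using rel d * unfolding relabels_def by (metis append_Cons list.inject)
    assume "s @ [True] \<in> dom (\<lambda>s. r (c @ s))"
    then have "(c @ s) @ [True] \<in> dom r" by auto
    then show "g (s @ [d]) = g s @ [d]"
      using rel d * unfolding relabels_def by (metis append_Cons list.inject)
  next
    fix p assume p: "p \<notin> g ` dom (\<lambda>s. r (c @ s))"
    have "b # p \<notin> \<phi> ` dom r"
    proof
      assume "b # p \<in> \<phi> ` dom r"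
      then obtain s where s: "s \<in> dom r" "\<phi> s = b # p" by (metis imageE)
      then have "prefix c s" using only by auto
      then obtain u where "s = c @ u" by (auto simp: prefix_def)
      then show False using s g[of u] p by (auto simp: dom_def)
    qed
    then show "subtree \<tau>' b p = subtree \<tau> b p"
      using rel unfolding relabels_def subtree_def by blast
  qed
  then show ?thesis by (simp add: g_def[abs_def])
qed

lemma relabels_unchanged:
  assumes "relabels \<phi> r \<tau> \<tau>'" "\<And>s. s \<in> dom r \<Longrightarrow> \<not> prefix [b] (\<phi> s)"
  shows "subtree \<tau>' b = subtree \<tau> b"
proof
  fix p
  have "b # p \<notin> \<phi> ` dom r"
  proof
    assume "b # p \<in> \<phi> ` dom r"
    then obtain s where "s \<in> dom r" "\<phi> s = b # p" by (metis imageE)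
    then show False using assms(2) by fastforce
  qed
  then show "subtree \<tau>' b p = subtree \<tau> b p"
    using assms(1) unfolding relabels_def subtree_def by blast
qed

text \<open>Converse of the restriction: occurrences in the children are glued below the root. Child
  \<open>c\<close> of the rule goes to branch \<open>g c\<close>, and \<open>\<psi> c\<close>
  continues from there; \<open>g\<close> is free only where the rule has a single child.\<close>

lemma relabels_node:
  assumes root: "r [] = Some (q, q')" "\<tau> [] = Some q" "\<tau>' [] = Some q'"
    and pc: "prefix_closed r"
    and sub: "\<And>c. [c] \<in> dom r \<Longrightarrow> \<psi> c [] = [] \<and>
      relabels (\<psi> c) (subtree r c) (subtree \<tau> (g c)) (subtree \<tau>' (g c))"
    and g: "\<And>c. [True] \<in> dom r \<Longrightarrow> g c = c"
    and unch: "\<And>b. b \<notin> g ` {c. [c] \<in> dom r} \<Longrightarrow> subtree \<tau>' b = subtree \<tau> b"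
  shows "\<exists>\<phi>. \<phi> [] = [] \<and> relabels \<phi> r \<tau> \<tau>'"
proof -
  define \<phi> where "\<phi> s = (case s of [] \<Rightarrow> [] | c # u \<Rightarrow> g c # \<psi> c u)" for s
  have \<phi>: "\<phi> [] = []" "\<phi> (c # u) = g c # \<psi> c u" for c u
    by (auto simp: \<phi>_def)
  have dom: "[c] \<in> dom r" if "c # u \<in> dom r" for c u
    using prefix_closedD[OF pc, of "[c]" u] that by simp
  have "relabels \<phi> r \<tau> \<tau>'"
    unfolding relabels_def
  proof (intro conjI ballI allI impI)
    fix s assume s: "s \<in> dom r"
    have "\<tau> (\<phi> s) = map_option fst (r s) \<and> \<tau>' (\<phi> s) = map_option snd (r s)"
    proof (cases s)
      case (Cons c u)
      then show ?thesis
        using sub[OF dom[of c u]] s unfolding relabels_def subtree_def dom_def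
        by (simp add: \<phi>)
    qed (simp add: root \<phi>)
    then show "\<tau> (\<phi> s) = map_option fst (r s)" "\<tau>' (\<phi> s) = map_option snd (r s)"
      by auto
  next
    fix s c assume sc: "s @ [c] \<in> dom r"
    have "(\<exists>b. \<phi> (s @ [c]) = \<phi> s @ [b]) \<and> (s @ [True] \<in> dom r \<longrightarrow> \<phi> (s @ [c]) = \<phi> s @ [c])"
    proof (cases s)
      case Nil
      then show ?thesis using sub[of c] sc g[of c] by (simp add: \<phi>)
    next
      case (Cons d u)
      then show ?thesis
        using sub[OF dom[of d "u @ [c]"]] sc unfolding relabels_def subtree_def dom_def
        by (simp add: \<phi>)
    qed
    then show "\<exists>b. \<phi> (s @ [c]) = \<phi> s @ [b]"
      "s @ [True] \<in> dom r \<Longrightarrow> \<phi> (s @ [c]) = \<phi> s @ [c]"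
      by auto
  next
    fix p assume p: "p \<notin> \<phi> ` dom r"
    show "\<tau>' p = \<tau> p"
    proof (cases p)
      case Nil
      then show ?thesis using p root \<phi>(1) by (metis domI image_eqI)
    next
      case (Cons b p')
      have "subtree \<tau>' b p' = subtree \<tau> b p'"
      proof (cases "b \<in> g ` {c. [c] \<in> dom r}")
        case True
        then obtain c where c: "[c] \<in> dom r" "b = g c" by auto
        have "p' \<notin> \<psi> c ` dom (subtree r c)"
        proof
          assume "p' \<in> \<psi> c ` dom (subtree r c)"
          then obtain u where "p' = \<psi> c u" "c # u \<in> dom r"
            by (auto simp: subtree_def)
          then have "p = \<phi> (c # u)" "c # u \<in> dom r" using Cons c \<phi> by simp_all
          then show False using p by blast
        qed
        then show ?thesis
          using sub[OF c(1)] c(2) unfolding relabels_def by blast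
      qed (simp add: unch)
      then show ?thesis by (simp add: Cons subtree_def)
    qed
  qed
  then show ?thesis using \<phi>(1) by blast
qed


section \<open>Rule trees by shape, and their term pairs\<close>

lemma rule_terms_leaf:
  "finite (dom r) \<Longrightarrow> r [] = Some (q, q') \<Longrightarrow> [False] \<notin> dom r \<Longrightarrow>
   rule_terms r = {(F q E E, F q' E E)}"
  by (subst rule_terms.simps) (auto simp: Let_def)

lemma rule_terms_both:
  "finite (dom r) \<Longrightarrow> r [] = Some (q, q') \<Longrightarrow> [False] \<in> dom r \<Longrightarrow> [True] \<in> dom r \<Longrightarrow>
   rule_terms r = {(F q \<rho>1 \<rho>2, F q' \<rho>3 \<rho>4) | \<rho>1 \<rho>2 \<rho>3 \<rho>4.
     (\<rho>1, \<rho>3) \<in> rule_terms (subtree r False) \<and> (\<rho>2, \<rho>4) \<in> rule_terms (subtree r True)}"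
  by (subst rule_terms.simps) (auto simp: Let_def)

lemma rule_terms_single:
  "finite (dom r) \<Longrightarrow> r [] = Some (q, q') \<Longrightarrow> [False] \<in> dom r \<Longrightarrow> [True] \<notin> dom r \<Longrightarrow>
   rule_terms r =
     {(F q \<rho>1 E, F q' \<rho>2 E) | \<rho>1 \<rho>2. (\<rho>1, \<rho>2) \<in> rule_terms (subtree r False)} \<union>
     {(F q E \<rho>1, F q' E \<rho>2) | \<rho>1 \<rho>2. (\<rho>1, \<rho>2) \<in> rule_terms (subtree r False)}"
  by (subst rule_terms.simps) (auto simp: Let_def)

lemma is_tree_induct [consumes 1, case_names leaf single both]:
  assumes "is_tree A r"
    and leaf: "\<And>r a. is_tree A r \<Longrightarrow> r [] = Some a \<Longrightarrow> [False] \<notin> dom r \<Longrightarrow> [True] \<notin> dom r \<Longrightarrow> P r"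
    and single: "\<And>r a. is_tree A r \<Longrightarrow> r [] = Some a \<Longrightarrow> [False] \<in> dom r \<Longrightarrow> [True] \<notin> dom r \<Longrightarrow>
      P (subtree r False) \<Longrightarrow> P r"
    and both: "\<And>r a. is_tree A r \<Longrightarrow> r [] = Some a \<Longrightarrow> [False] \<in> dom r \<Longrightarrow> [True] \<in> dom r \<Longrightarrow>
      P (subtree r False) \<Longrightarrow> P (subtree r True) \<Longrightarrow> P r"
  shows "P r"
  using assms(1)
proof (induction "card (dom r)" arbitrary: r rule: less_induct)
  case less
  have fin: "finite (dom r)" and root: "[] \<in> dom r"
    using less.prems is_tree_root by (auto simp: is_tree_def)
  have IH: "P (subtree r b)" if "[b] \<in> dom r" for b
    using less.hyps[OF card_dom_subtree[OF fin root] is_tree_subtree[OF less.prems that]] .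
  have "[False] \<in> dom r" if "[True] \<in> dom r"
    using less.prems that unfolding is_tree_def by (metis append_Nil)
  moreover obtain a where "r [] = Some a" using root by auto
  ultimately show ?case
    using less.prems leaf single both IH by metis
qed

text \<open>Only membership in \<open>gterms\<close> can be expected: a rule node with one child
  contributes an incomplete term \<open>F q \<rho> E\<close> or \<open>F q E \<rho>\<close>.\<close>

lemma rule_terms_gterms:
  "is_tree (Q \<times> Q) r \<Longrightarrow> (\<rho>1, \<rho>2) \<in> rule_terms r \<Longrightarrow> \<rho>1 \<in> gterms Q \<and> \<rho>2 \<in> gterms Q"
proof (induction arbitrary: \<rho>1 \<rho>2 rule: is_tree_induct)
  case (leaf r a)
  moreover have "a \<in> Q \<times> Q" "finite (dom r)"
    using leaf unfolding is_tree_def by (auto intro: ranI)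
  ultimately show ?case by (cases a) (auto simp: rule_terms_leaf)
next
  case (single r a)
  moreover have "a \<in> Q \<times> Q" "finite (dom r)"
    using single unfolding is_tree_def by (auto intro: ranI)
  ultimately show ?case by (cases a) (auto simp: rule_terms_single)
next
  case (both r a)
  moreover have "a \<in> Q \<times> Q" "finite (dom r)"
    using both unfolding is_tree_def by (auto intro: ranI)
  ultimately show ?case by (cases a) (auto simp: rule_terms_both)
qed

section \<open>Rule occurrences correspond to rewrite steps on terms\<close>

lemma relabels_dom: "relabels \<phi> r \<tau> \<tau>' \<Longrightarrow> s \<in> dom r \<Longrightarrow> \<phi> s \<in> dom \<tau>"
  by (auto simp: relabels_def domIff)

lemma relabels_root:
  assumes "relabels \<phi> r \<tau> \<tau>'" "\<phi> [] = []" "r [] = Some (q, q')"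
  shows "\<tau> [] = Some q" "\<tau>' [] = Some q'"
proof -
  have "[] \<in> dom r" using assms(3) by blast
  then have "\<tau> (\<phi> []) = map_option fst (r []) \<and> \<tau>' (\<phi> []) = map_option snd (r [])"
    using assms(1) unfolding relabels_def by blast
  then show "\<tau> [] = Some q" "\<tau>' [] = Some q'" using assms(2,3) by simp_all
qed

text \<open>\<open>\<tau>'\<close> is an arbitrary partial map here; that it comes from a term is
  part of the result. At rule nodes with one child, the direction taken by \<open>\<phi>\<close>
  selects the member of \<open>rule_terms r\<close>.\<close>

lemma relabels_root_imp_inst:
  assumes "is_tree A r" "\<phi> [] = []" "relabels \<phi> r (of_term t) \<tau>'"
  shows "\<exists>(\<rho>1, \<rho>2) \<in> rule_terms r. \<exists>t'. of_term t' = \<tau>' \<and> inst \<rho>1 \<rho>2 t t'"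
  using assms
proof (induction arbitrary: t \<tau>' \<phi> rule: is_tree_induct)
  case (leaf r a)
  obtain q q' where a: "a = (q, q')" by (cases a)
  have pc: "prefix_closed r" and fin: "finite (dom r)"
    using leaf.hyps(1) is_tree_prefix_closed by (auto simp: is_tree_def)
  have lab: "of_term t [] = Some q" "\<tau>' [] = Some q'"
    using relabels_root[OF leaf.prems(2,1)] leaf.hyps(2) a by auto
  then obtain t1 t2 where t: "t = F q t1 t2" by (cases t) auto
  have dom: "s \<in> dom r \<Longrightarrow> s = []" for s
    using prefix_closedD[OF pc, of "[hd s]" "tl s"] leaf.hyps by (cases s; cases "hd s") auto
  have "subtree \<tau>' b = subtree (of_term t) b" for b
  proof (rule relabels_unchanged[OF leaf.prems(2)])
    fix s assume "s \<in> dom r"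
    from dom[OF this] show "\<not> prefix [b] (\<phi> s)" using leaf.prems(1) by simp
  qed
  then have "of_term (F q' t1 t2) = \<tau>'"
    using lab t by (auto intro!: node_eqI[symmetric])
  then show ?case
    using rule_terms_leaf[OF fin, of q q'] leaf.hyps a t
    by (auto intro!: exI[of _ "F q' t1 t2"] inst.intros)
next
  case (single r a)
  obtain q q' where a: "a = (q, q')" by (cases a)
  have pc: "prefix_closed r" and fin: "finite (dom r)"
    using single.hyps(1) is_tree_prefix_closed by (auto simp: is_tree_def)
  have lab: "of_term t [] = Some q" "\<tau>' [] = Some q'"
    using relabels_root[OF single.prems(2,1)] single.hyps(2) a by auto
  then obtain t1 t2 where t: "t = F q t1 t2" by (cases t) auto
  have dom: "prefix [False] s" if "s \<in> dom r" "s \<noteq> []" for s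
    using prefix_closedD[OF pc, of "[hd s]" "tl s"] single.hyps that
    by (cases s; cases "hd s") auto
  \<comment> \<open>The only child of the rule's root lands in some branch \<open>b\<close>. The
    other branch is untouched and faces an \<open>e\<close> in both components of the pair.\<close>
  have "[] @ [False] \<in> dom r" using single.hyps by simp
  then have "\<exists>b. \<phi> ([] @ [False]) = \<phi> [] @ [b]"
    using single.prems(2) unfolding relabels_def by blast
  then obtain b where b: "\<phi> [False] = [b]"
    using single.prems(1) by auto
  have pre: "prefix [b] (\<phi> s)" if s: "s \<in> dom r" "s \<noteq> []" for s
  proof -
    obtain u where "s = [False] @ u" using dom[OF s] by (auto simp: prefix_def)
    then show ?thesis using relabels_prefix[OF single.prems(2) pc, of "[False]" u] b s by simp
  qed
  have "relabels (\<lambda>s. tl (\<phi> ([False] @ s))) (\<lambda>s. r ([False] @ s))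
      (subtree (of_term t) b) (subtree \<tau>' b)"
    using pre dom single.prems(1) by (intro relabels_child[OF single.prems(2) pc]) force+
  then have "relabels (\<lambda>s. tl (\<phi> (False # s))) (subtree r False)
      (of_term (if b then t2 else t1)) (subtree \<tau>' b)"
    by (cases b) (simp_all add: t subtree_def[of r])
  from single.IH[OF _ this] b obtain \<rho>1 \<rho>2 t' where
    t': "(\<rho>1, \<rho>2) \<in> rule_terms (subtree r False)" "of_term t' = subtree \<tau>' b"
      "inst \<rho>1 \<rho>2 (if b then t2 else t1) t'"
    by auto
  have "subtree \<tau>' (\<not> b) = subtree (of_term t) (\<not> b)"
  proof (rule relabels_unchanged[OF single.prems(2)])
    fix s assume "s \<in> dom r"
    then show "\<not> prefix [\<not> b] (\<phi> s)"
      using pre[of s] single.prems(1) by (cases "s = []") (auto simp: prefix_def)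
  qed
  then have other: "subtree \<tau>' (\<not> b) = of_term (if b then t1 else t2)"
    by (simp add: t)
  note rt = rule_terms_single[OF fin single.hyps(2)[unfolded a] single.hyps(3,4)]
  show ?case
  proof (cases b)
    case True
    have "of_term (F q' t1 t') = \<tau>'"
      using lab t' other True by (auto intro!: node_eqI[symmetric])
    moreover have "inst (F q E \<rho>1) (F q' E \<rho>2) t (F q' t1 t')"
      using t' True t by (auto intro: inst.intros)
    ultimately show ?thesis using t'(1) unfolding rt by blast
  next
    case False
    have "of_term (F q' t' t2) = \<tau>'"
      using lab t' other False by (auto intro!: node_eqI[symmetric])
    moreover have "inst (F q \<rho>1 E) (F q' \<rho>2 E) t (F q' t' t2)"
      using t' False t by (auto intro: inst.intros)
    ultimately show ?thesis using t'(1) unfolding rt by blast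
  qed
next
  case (both r a)
  obtain q q' where a: "a = (q, q')" by (cases a)
  have pc: "prefix_closed r" and fin: "finite (dom r)"
    using both.hyps(1) is_tree_prefix_closed by (auto simp: is_tree_def)
  have lab: "of_term t [] = Some q" "\<tau>' [] = Some q'"
    using relabels_root[OF both.prems(2,1)] both.hyps(2) a by auto
  then obtain t1 t2 where t: "t = F q t1 t2" by (cases t) auto
  have \<phi>: "\<phi> [c] = [c]" for c
  proof -
    have "[] @ [c] \<in> dom r" "[] @ [True] \<in> dom r" using both.hyps by (cases c; simp)+
    then have "\<phi> ([] @ [c]) = \<phi> [] @ [c]"
      using both.prems(2) unfolding relabels_def by blast
    then show ?thesis using both.prems(1) by simp
  qed
  have pre: "prefix [c] (\<phi> ([c] @ u))" if "[c] @ u \<in> dom r" for c u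
    using relabels_prefix[OF both.prems(2) pc that] \<phi> by simp
  have rel: "relabels (\<lambda>s. tl (\<phi> (b # s))) (subtree r b)
      (of_term (if b then t2 else t1)) (subtree \<tau>' b)" for b
  proof -
    have "prefix [b] s" if "s \<in> dom r" "prefix [b] (\<phi> s)" for s
      using that pre[of "hd s" "tl s"] both.prems(1) by (cases s) (auto simp: prefix_def)
    then have "relabels (\<lambda>s. tl (\<phi> ([b] @ s))) (\<lambda>s. r ([b] @ s))
        (subtree (of_term t) b) (subtree \<tau>' b)"
      using pre by (intro relabels_child[OF both.prems(2) pc])
    then show ?thesis by (cases b) (simp_all add: t subtree_def[of r])
  qed
  from both.IH(1)[OF _ rel] \<phi> obtain \<rho>1 \<rho>3 t1' where
    1: "(\<rho>1, \<rho>3) \<in> rule_terms (subtree r False)" "of_term t1' = subtree \<tau>' False"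
      "inst \<rho>1 \<rho>3 t1 t1'"
    by auto
  from both.IH(2)[OF _ rel] \<phi> obtain \<rho>2 \<rho>4 t2' where
    2: "(\<rho>2, \<rho>4) \<in> rule_terms (subtree r True)" "of_term t2' = subtree \<tau>' True"
      "inst \<rho>2 \<rho>4 t2 t2'"
    by auto
  note rt = rule_terms_both[OF fin both.hyps(2)[unfolded a] both.hyps(3,4)]
  have "of_term (F q' t1' t2') = \<tau>'"
    using lab 1 2 by (auto intro!: node_eqI[symmetric])
  moreover have "inst (F q \<rho>1 \<rho>2) (F q' \<rho>3 \<rho>4) t (F q' t1' t2')"
    using 1 2 t by (auto intro: inst.intros)
  ultimately show ?case using 1(1) 2(1) unfolding rt by blast
qed

lemma inst_imp_relabels_root:
  assumes "is_tree A r" "(\<rho>1, \<rho>2) \<in> rule_terms r" "inst \<rho>1 \<rho>2 t t'"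
  shows "\<exists>\<phi>. \<phi> [] = [] \<and> relabels \<phi> r (of_term t) (of_term t')"
  using assms
proof (induction arbitrary: t t' \<rho>1 \<rho>2 rule: is_tree_induct)
  case (leaf r a)
  obtain q q' where a: "a = (q, q')" by (cases a)
  have pc: "prefix_closed r" and fin: "finite (dom r)"
    using leaf.hyps(1) is_tree_prefix_closed by (auto simp: is_tree_def)
  have "\<rho>1 = F q E E" "\<rho>2 = F q' E E"
    using leaf a fin by (auto simp: rule_terms_leaf)
  with leaf.prems(2) obtain t1 t2 where t: "t = F q t1 t2" "t' = F q' t1 t2"
    by (auto elim!: inst.cases)
  \<comment> \<open>The rule has no children, so the maps for the children in
    \<open>relabels_node\<close> are subject to no condition.\<close>
  have "[c] \<notin> dom r" for c using leaf.hyps by (cases c) auto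
  then show ?case
    using leaf.hyps(2) a pc t by (intro relabels_node) auto
next
  case (single r a)
  obtain q q' where a: "a = (q, q')" by (cases a)
  have pc: "prefix_closed r" and fin: "finite (dom r)"
    using single.hyps(1) is_tree_prefix_closed by (auto simp: is_tree_def)
  \<comment> \<open>The flag \<open>b\<close> tells on which side the pair continues, so that both
    families of \<open>rule_terms_single\<close> are treated at once.\<close>
  obtain \<sigma>1 \<sigma>2 t1 t2 t1' t2' b where
    t: "t = F q t1 t2" "t' = F q' t1' t2'" "(\<sigma>1, \<sigma>2) \<in> rule_terms (subtree r False)"
      "inst \<sigma>1 \<sigma>2 (if b then t2 else t1) (if b then t2' else t1')"
      "(if b then t1 else t2) = (if b then t1' else t2')"
  proof -
    have "(\<exists>\<sigma>1 \<sigma>2. \<rho>1 = F q \<sigma>1 E \<and> \<rho>2 = F q' \<sigma>2 E \<and> (\<sigma>1, \<sigma>2) \<in> rule_terms (subtree r False)) \<or>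
      (\<exists>\<sigma>1 \<sigma>2. \<rho>1 = F q E \<sigma>1 \<and> \<rho>2 = F q' E \<sigma>2 \<and> (\<sigma>1, \<sigma>2) \<in> rule_terms (subtree r False))"
      using single.prems(1)
      unfolding rule_terms_single[OF fin single.hyps(2)[unfolded a] single.hyps(3,4)] by blast
    then show ?thesis
    proof (elim disjE exE conjE)
      fix \<sigma>1 \<sigma>2 assume *: "\<rho>1 = F q \<sigma>1 E" "\<rho>2 = F q' \<sigma>2 E" "(\<sigma>1, \<sigma>2) \<in> rule_terms (subtree r False)"
      from single.prems(2) obtain t1 t1' t2 where "t = F q t1 t2" "t' = F q' t1' t2" "inst \<sigma>1 \<sigma>2 t1 t1'"
        unfolding * by (cases rule: inst.cases) (auto elim: inst.cases)
      then show ?thesis using that[where b = False] * by simp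
    next
      fix \<sigma>1 \<sigma>2 assume *: "\<rho>1 = F q E \<sigma>1" "\<rho>2 = F q' E \<sigma>2" "(\<sigma>1, \<sigma>2) \<in> rule_terms (subtree r False)"
      from single.prems(2) obtain t1 t2 t2' where "t = F q t1 t2" "t' = F q' t1 t2'" "inst \<sigma>1 \<sigma>2 t2 t2'"
        unfolding * by (cases rule: inst.cases) (auto elim: inst.cases)
      then show ?thesis using that[where b = True] * by simp
    qed
  qed
  from single.IH[OF t(3,4)] obtain \<psi> where \<psi>: "\<psi> [] = []"
    "relabels \<psi> (subtree r False) (of_term (if b then t2 else t1)) (of_term (if b then t2' else t1'))"
    by blast
  show ?case
  proof (rule relabels_node[where g = "\<lambda>_. b" and \<psi> = "\<lambda>_. \<psi>"])
    fix c assume "[c] \<in> dom r"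
    then have "c = False" using single.hyps by (cases c) auto
    then show "\<psi> [] = [] \<and>
        relabels \<psi> (subtree r c) (subtree (of_term t) b) (subtree (of_term t') b)"
      using \<psi> t by (cases b) auto
  next
    fix d assume "d \<notin> (\<lambda>_. b) ` {c. [c] \<in> dom r}"
    then have "d = (\<not> b)" using single.hyps by auto
    then show "subtree (of_term t') d = subtree (of_term t) d"
      using t by (cases b) auto
  qed (use single.hyps a t pc in auto)
next
  case (both r a)
  obtain q q' where a: "a = (q, q')" by (cases a)
  have pc: "prefix_closed r" and fin: "finite (dom r)"
    using both.hyps(1) is_tree_prefix_closed by (auto simp: is_tree_def)
  obtain \<sigma>1 \<sigma>2 \<sigma>3 \<sigma>4 where \<rho>: "\<rho>1 = F q \<sigma>1 \<sigma>2" "\<rho>2 = F q' \<sigma>3 \<sigma>4"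
    "(\<sigma>1, \<sigma>3) \<in> rule_terms (subtree r False)" "(\<sigma>2, \<sigma>4) \<in> rule_terms (subtree r True)"
    using both.prems(1)
    unfolding rule_terms_both[OF fin both.hyps(2)[unfolded a] both.hyps(3,4)] by blast
  from both.prems(2) obtain t1 t2 t1' t2' where t: "t = F q t1 t2" "t' = F q' t1' t2'"
    "inst \<sigma>1 \<sigma>3 t1 t1'" "inst \<sigma>2 \<sigma>4 t2 t2'"
    unfolding \<rho> by (cases rule: inst.cases) auto
  from both.IH(1)[OF \<rho>(3) t(3)] obtain \<psi>1 where \<psi>1: "\<psi>1 [] = []"
    "relabels \<psi>1 (subtree r False) (of_term t1) (of_term t1')" by blast
  from both.IH(2)[OF \<rho>(4) t(4)] obtain \<psi>2 where \<psi>2: "\<psi>2 [] = []"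
    "relabels \<psi>2 (subtree r True) (of_term t2) (of_term t2')" by blast
  have dom: "[c] \<in> dom r" for c using both.hyps by (cases c) auto
  show ?case
  proof (rule relabels_node[where g = "\<lambda>c. c" and \<psi> = "\<lambda>c. if c then \<psi>2 else \<psi>1"])
    fix c
    show "(if c then \<psi>2 else \<psi>1) [] = [] \<and> relabels (if c then \<psi>2 else \<psi>1) (subtree r c)
        (subtree (of_term t) c) (subtree (of_term t') c)"
      using \<psi>1 \<psi>2 t by (cases c) auto
  next
    fix b assume "b \<notin> (\<lambda>c. c) ` {c. [c] \<in> dom r}"
    then show "subtree (of_term t') b = subtree (of_term t) b"
      using dom by simp
  qed (use both.hyps a t pc in auto)
qed

text \<open>The induction on \<open>t\<close> walks down to the image of the rule's root: if
  \<open>\<phi> []\<close> starts with \<open>b\<close>, the entire occurrence lies in branch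
  \<open>b\<close>; if it is empty, \<open>relabels_root_imp_inst\<close> applies.\<close>

lemma relabels_imp_tstep:
  assumes r: "is_tree A r" "r \<in> R" and "relabels \<phi> r (of_term t) \<tau>'"
  shows "\<exists>t'. of_term t' = \<tau>' \<and> tstep (\<Union>r\<in>R. rule_terms r) t t'"
  using assms(3)
proof (induction t arbitrary: \<phi> \<tau>')
  case (F q t1 t2)
  let ?t = "F q t1 t2" and ?P = "\<Union>r\<in>R. rule_terms r"
  have pc: "prefix_closed r" by (rule is_tree_prefix_closed[OF r(1)])
  show ?case
  proof (cases "\<phi> []")
    case Nil
    show ?thesis
      using relabels_root_imp_inst[OF r(1) Nil F.prems] r(2) by (blast intro: tstep.root)
  next
    case (Cons b p)
    have pre: "prefix [b] (\<phi> s)" if "s \<in> dom r" for s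
      using relabels_prefix[OF F.prems pc, of "[]" s] that Cons by (auto simp: prefix_def)
    have "relabels (\<lambda>s. tl (\<phi> ([] @ s))) (\<lambda>s. r ([] @ s)) (subtree (of_term ?t) b) (subtree \<tau>' b)"
      using pre by (intro relabels_child[OF F.prems pc]) auto
    then have rel: "relabels (\<lambda>s. tl (\<phi> s)) r (of_term (if b then t2 else t1)) (subtree \<tau>' b)"
      by (cases b) simp_all
    have "subtree \<tau>' (\<not> b) = subtree (of_term ?t) (\<not> b)"
    proof (rule relabels_unchanged[OF F.prems])
      fix s assume "s \<in> dom r"
      from pre[OF this] show "\<not> prefix [\<not> b] (\<phi> s)" by (auto simp: prefix_def)
    qed
    then have other: "subtree \<tau>' (\<not> b) = of_term (if b then t1 else t2)" by simp
    have "[] \<notin> \<phi> ` dom r" using pre by fastforce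
    then have lab: "\<tau>' [] = Some q"
      using F.prems unfolding relabels_def by simp
    show ?thesis
    proof (cases b)
      case True
      then obtain t2' where t2': "of_term t2' = subtree \<tau>' True" "tstep ?P t2 t2'"
        using F.IH(2) rel by auto
      have "of_term (F q t1 t2') = \<tau>'"
        using lab t2' other True by (auto intro!: node_eqI[symmetric])
      then show ?thesis using t2' by (blast intro: tstep.right)
    next
      case False
      then obtain t1' where t1': "of_term t1' = subtree \<tau>' False" "tstep ?P t1 t1'"
        using F.IH(1) rel by auto
      have "of_term (F q t1' t2) = \<tau>'"
        using lab t1' other False by (auto intro!: node_eqI[symmetric])
      then show ?thesis using t1' by (blast intro: tstep.left)
    qed
  qed
\<comment> \<open>For a variable or \<open>e\<close> the map is empty and cannot receive the root of
  the rule.\<close>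
qed (use relabels_dom is_tree_root[OF r(1)] in fastforce)+

lemma relabels_Cons:
  assumes "relabels \<phi> r (subtree \<tau> b) (subtree \<tau>' b)"
    and "\<tau>' [] = \<tau> []" "subtree \<tau>' (\<not> b) = subtree \<tau> (\<not> b)"
  shows "relabels (\<lambda>s. b # \<phi> s) r \<tau> \<tau>'"
  unfolding relabels_def
proof (intro conjI ballI allI impI)
  fix p assume p: "p \<notin> (\<lambda>s. b # \<phi> s) ` dom r"
  show "\<tau>' p = \<tau> p"
  proof (cases p)
    case (Cons c p')
    have "subtree \<tau>' c p' = subtree \<tau> c p'"
    proof (cases "c = b")
      case True
      then have "p' \<notin> \<phi> ` dom r" using p Cons by blast
      then show ?thesis using assms(1) True unfolding relabels_def by blast
    next
      case False
      then have "c = (\<not> b)" by auto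
      then show ?thesis using assms(3) by simp
    qed
    then show ?thesis by (simp add: Cons subtree_def)
  qed (simp add: assms(2))
qed (use assms(1) in \<open>auto simp: relabels_def subtree_def\<close>)

lemma tstep_imp_relabels:
  assumes R: "\<forall>r\<in>R. is_tree A r" and "tstep (\<Union>r\<in>R. rule_terms r) t t'"
  shows "\<exists>r\<in>R. \<exists>\<phi>. relabels \<phi> r (of_term t) (of_term t')"
  using assms(2)
proof induction
  case (root \<rho>1 \<rho>2 t t')
  then obtain r where "r \<in> R" "(\<rho>1, \<rho>2) \<in> rule_terms r" by blast
  then show ?case using inst_imp_relabels_root root.hyps(2) R by blast
next
  case (left t1 t1' q t2)
  then obtain r \<phi> where "r \<in> R" "relabels \<phi> r (of_term t1) (of_term t1')" by blast
  then show ?case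
    using relabels_Cons[of \<phi> r "of_term (F q t1 t2)" False "of_term (F q t1' t2)"] by auto
next
  case (right t2 t2' q t1)
  then obtain r \<phi> where "r \<in> R" "relabels \<phi> r (of_term t2) (of_term t2')" by blast
  then show ?case
    using relabels_Cons[of \<phi> r "of_term (F q t1 t2)" True "of_term (F q t1 t2')"] by auto
qed

lemma step_of_term_iff:
  assumes R: "\<forall>r\<in>R. is_tree (Q \<times> Q) r" and "complete_tree Q (of_term t)"
  shows "step Q R (of_term t) \<tau>' \<longleftrightarrow>
    (\<exists>t'. of_term t' = \<tau>' \<and> tstep (\<Union>r\<in>R. rule_terms r) t t')"
  unfolding step_iff_relabels[OF R]
  using assms relabels_imp_tstep tstep_imp_relabels[OF R] by blast

section \<open>Recognizable sets of terms\<close>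

text \<open>The congruence is the kernel of \<open>h\<close>, and the values of \<open>h\<close> are
  names for its classes; later they become the elements of the model.\<close>

definition finite_congruence :: "'q set \<Rightarrow> ('q tm \<Rightarrow> 'b) \<Rightarrow> bool" where
  "finite_congruence Q h \<longleftrightarrow> finite (h ` gterms Q) \<and>
     (\<forall>q\<in>Q. \<forall>t1\<in>gterms Q. \<forall>t2\<in>gterms Q. \<forall>t1'\<in>gterms Q. \<forall>t2'\<in>gterms Q.
        h t1 = h t1' \<longrightarrow> h t2 = h t2' \<longrightarrow> h (F q t1 t2) = h (F q t1' t2'))"

definition saturates :: "'q set \<Rightarrow> ('q tm \<Rightarrow> 'b) \<Rightarrow> 'q tm set \<Rightarrow> bool" where
  "saturates Q h V \<longleftrightarrow> (\<forall>t\<in>gterms Q. \<forall>t'\<in>gterms Q. h t = h t' \<longrightarrow> t \<in> V \<longrightarrow> t' \<in> V)"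

text \<open>The Myhill-Nerode form of regularity for tree languages. Naming classes by natural
  numbers avoids an existential quantifier over types and provides the \<open>nat\<close> universe
  of the final model.\<close>

definition recognizable :: "'q set \<Rightarrow> 'q tm set \<Rightarrow> bool" where
  "recognizable Q V \<longleftrightarrow> (\<exists>h :: 'q tm \<Rightarrow> nat. finite_congruence Q h \<and> saturates Q h V)"

lemma finite_congruenceI:
  assumes "finite (h ` gterms Q)"
    and "\<And>q t1 t2 t1' t2'. q \<in> Q \<Longrightarrow> t1 \<in> gterms Q \<Longrightarrow> t2 \<in> gterms Q \<Longrightarrow> t1' \<in> gterms Q \<Longrightarrow>
      t2' \<in> gterms Q \<Longrightarrow> h t1 = h t1' \<Longrightarrow> h t2 = h t2' \<Longrightarrow> h (F q t1 t2) = h (F q t1' t2')"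
  shows "finite_congruence Q h"
  using assms unfolding finite_congruence_def by blast

lemma finite_congruenceD:
  assumes "finite_congruence Q h" "q \<in> Q" "t1 \<in> gterms Q" "t2 \<in> gterms Q" "t1' \<in> gterms Q"
    "t2' \<in> gterms Q" "h t1 = h t1'" "h t2 = h t2'"
  shows "h (F q t1 t2) = h (F q t1' t2')"
  using assms unfolding finite_congruence_def by blast

lemma saturatesD:
  "saturates Q h V \<Longrightarrow> t \<in> gterms Q \<Longrightarrow> t' \<in> gterms Q \<Longrightarrow> h t = h t' \<Longrightarrow> t \<in> V \<Longrightarrow> t' \<in> V"
  unfolding saturates_def by blast

text \<open>Finitely many classes of any type can be renamed injectively by natural numbers, so the
  constructions below may use pairs and sets as class names.\<close>

lemma recognizableI:
  assumes "finite_congruence Q h" "saturates Q h V"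
  shows "recognizable Q V"
proof -
  obtain g :: "_ \<Rightarrow> nat" where g: "inj_on g (h ` gterms Q)"
    using assms(1) finite_imp_inj_to_nat_seg unfolding finite_congruence_def by metis
  have eq: "g (h t) = g (h t') \<longleftrightarrow> h t = h t'" if "t \<in> gterms Q" "t' \<in> gterms Q" for t t'
    using g that by (auto dest: inj_onD)
  have "(\<lambda>t. g (h t)) ` gterms Q = g ` h ` gterms Q"
    by (simp add: image_image)
  then have "finite ((\<lambda>t. g (h t)) ` gterms Q)"
    using assms(1) unfolding finite_congruence_def by simp
  then have "finite_congruence Q (\<lambda>t. g (h t))"
    using finite_congruenceD[OF assms(1)] eq by (intro finite_congruenceI) metis+
  moreover have "saturates Q (\<lambda>t. g (h t)) V"
    using assms(2) eq unfolding saturates_def by blast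
  ultimately show ?thesis unfolding recognizable_def by blast
qed

lemma finite_congruence_Pair:
  assumes "finite_congruence Q h1" "finite_congruence Q h2"
  shows "finite_congruence Q (\<lambda>t. (h1 t, h2 t))"
proof -
  have "(\<lambda>t. (h1 t, h2 t)) ` gterms Q \<subseteq> h1 ` gterms Q \<times> h2 ` gterms Q" by auto
  then have "finite ((\<lambda>t. (h1 t, h2 t)) ` gterms Q)"
    using assms unfolding finite_congruence_def by (meson finite_SigmaI finite_subset)
  then show ?thesis
  proof (rule finite_congruenceI)
    fix q t1 t2 t1' t2'
    assume F: "q \<in> Q" "t1 \<in> gterms Q" "t2 \<in> gterms Q" "t1' \<in> gterms Q" "t2' \<in> gterms Q"
      and "(h1 t1, h2 t1) = (h1 t1', h2 t1')" "(h1 t2, h2 t2) = (h1 t2', h2 t2')"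
    then show "(h1 (F q t1 t2), h2 (F q t1 t2)) = (h1 (F q t1' t2'), h2 (F q t1' t2'))"
      using finite_congruenceD[OF assms(1) F] finite_congruenceD[OF assms(2) F] by simp
  qed
qed

section \<open>Closure properties of recognizable sets\<close>

lemma recognizable_Un:
  assumes "recognizable Q V" "recognizable Q W"
  shows "recognizable Q (V \<union> W)"
proof -
  obtain h1 h2 :: "_ \<Rightarrow> nat" where h: "finite_congruence Q h1" "saturates Q h1 V"
    "finite_congruence Q h2" "saturates Q h2 W"
    using assms unfolding recognizable_def by blast
  then have "saturates Q (\<lambda>t. (h1 t, h2 t)) (V \<union> W)"
    unfolding saturates_def by blast
  then show ?thesis using recognizableI finite_congruence_Pair h by blast
qed

lemma recognizable_Int:
  assumes "recognizable Q V" "recognizable Q W"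
  shows "recognizable Q (V \<inter> W)"
proof -
  obtain h1 h2 :: "_ \<Rightarrow> nat" where h: "finite_congruence Q h1" "saturates Q h1 V"
    "finite_congruence Q h2" "saturates Q h2 W"
    using assms unfolding recognizable_def by blast
  then have "saturates Q (\<lambda>t. (h1 t, h2 t)) (V \<inter> W)"
    unfolding saturates_def by blast
  then show ?thesis using recognizableI finite_congruence_Pair h by blast
qed

text \<open>Completeness alone is no congruence: \<open>e\<close> and an incomplete term such as
  \<open>F q E (F q E E)\<close> both lack it, but only \<open>e\<close> may appear below a complete
  leaf. Hence the first component.\<close>

lemma recognizable_cterms: "recognizable Q (cterms Q)"
proof (rule recognizableI)
  show "finite_congruence Q (\<lambda>t. (t = E, t \<in> cterms Q))"
  proof (rule finite_congruenceI)
    show "finite ((\<lambda>t. (t = E, t \<in> cterms Q)) ` gterms Q)"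
      by (rule finite_subset[of _ UNIV]) auto
  qed (auto simp: F_in_cterms_iff)
  show "saturates Q (\<lambda>t. (t = E, t \<in> cterms Q)) (cterms Q)"
    by (simp add: saturates_def)
qed

lemma run_F_iff:
  "run A (F q t1 t2) \<theta> \<longleftrightarrow> (\<exists>\<theta>1 \<theta>2. run A t1 \<theta>1 \<and> run A t2 \<theta>2 \<and> (q, \<theta>1, \<theta>2, \<theta>) \<in> node_rules A)"
  by (subst run.simps) auto

lemma run_states: "tree_automaton Q A \<Longrightarrow> run A t \<theta> \<Longrightarrow> \<theta> \<in> states A"
  by (auto simp: tree_automaton_def elim: run.cases)

text \<open>The subset construction: a term is classified by the set of states it can reach.\<close>

lemma recognizable_language:
  assumes "tree_automaton Q A"
  shows "recognizable Q (language A)"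
proof (rule recognizableI)
  have "(\<lambda>t. Collect (run A t)) ` gterms Q \<subseteq> Pow (states A)"
    using run_states[OF assms] by auto
  then have "finite ((\<lambda>t. Collect (run A t)) ` gterms Q)"
    using assms unfolding tree_automaton_def by (meson finite_Pow_iff finite_subset)
  then show "finite_congruence Q (\<lambda>t. Collect (run A t))"
    by (rule finite_congruenceI) (simp add: run_F_iff set_eq_iff)
  show "saturates Q (\<lambda>t. Collect (run A t)) (language A)"
    unfolding saturates_def language_def by blast
qed

text \<open>The class of \<open>t\<close> is the set of \<open>h\<close>-classes of ground terms
  embedded into \<open>t\<close>, a member of a finite power set. It is a congruence by
  \<open>embeds_F_iff\<close>, because embedded terms can be exchanged for
  \<open>h\<close>-equivalent ones child by child.\<close>

lemma recognizable_embeds_closure: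
  assumes "recognizable Q V"
  shows "recognizable Q {t \<in> gterms Q. \<exists>s \<in> V \<inter> gterms Q. of_term s \<preceq> of_term t}"
proof -
  obtain h :: "_ \<Rightarrow> nat" where h: "finite_congruence Q h" "saturates Q h V"
    using assms unfolding recognizable_def by blast
  define k where "k t = h ` {s \<in> gterms Q. of_term s \<preceq> of_term t}" for t
  have kI: "h s \<in> k t" if "s \<in> gterms Q" "of_term s \<preceq> of_term t" for s t
    using that by (simp add: k_def)
  have kE: "\<exists>s. x = h s \<and> s \<in> gterms Q \<and> of_term s \<preceq> of_term t" if "x \<in> k t" for x t
    using that by (auto simp: k_def)
  have sub: "k (F q t1 t2) \<subseteq> k (F q t1' t2')"
    if q: "q \<in> Q" and k: "k t1 = k t1'" "k t2 = k t2'" for q t1 t2 t1' t2'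
  proof
    fix x assume "x \<in> k (F q t1 t2)"
    then obtain s where s: "x = h s" "s \<in> gterms Q" "of_term s \<preceq> of_term (F q t1 t2)"
      using kE by blast
    have mono: "k t1' \<subseteq> k (F q t1' t2')" "k t2' \<subseteq> k (F q t1' t2')"
      using embeds_F_iff[of _ q t1' t2'] unfolding k_def by blast+
    from s(3)[unfolded embeds_F_iff] show "x \<in> k (F q t1' t2')"
    proof (elim disjE exE conjE)
      assume "of_term s \<preceq> of_term t1"
      from kI[OF s(2) this] show ?thesis using s(1) k(1) mono(1) by blast
    next
      assume "of_term s \<preceq> of_term t2"
      from kI[OF s(2) this] show ?thesis using s(1) k(2) mono(2) by blast
    next
      fix s1 s2 assume *: "s = F q s1 s2" "of_term s1 \<preceq> of_term t1" "of_term s2 \<preceq> of_term t2"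
      then have g: "s1 \<in> gterms Q" "s2 \<in> gterms Q" using s(2) by simp_all
      have "h s1 \<in> k t1'" "h s2 \<in> k t2'"
        using kI[OF g(1) *(2)] kI[OF g(2) *(3)] k by simp_all
      then obtain s1' s2' where s': "h s1 = h s1'" "s1' \<in> gterms Q" "of_term s1' \<preceq> of_term t1'"
        "h s2 = h s2'" "s2' \<in> gterms Q" "of_term s2' \<preceq> of_term t2'"
        using kE by meson
      \<comment> \<open>The children are exchanged for equivalent terms that embed into
        \<open>t1'\<close> and \<open>t2'\<close>; the congruence property of \<open>h\<close> keeps
        the class of the whole.\<close>
      have "x = h (F q s1' s2')"
        using finite_congruenceD[OF h(1) q g s'(2,5,1,4)] s(1) *(1) by simp
      moreover have "F q s1' s2' \<in> gterms Q" using s'(2,5) q by simp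
      moreover have "of_term (F q s1' s2') \<preceq> of_term (F q t1' t2')"
        unfolding embeds_F_iff using s'(3,6) by blast
      ultimately show ?thesis using kI by blast
    qed
  qed
  have "k ` gterms Q \<subseteq> Pow (h ` gterms Q)" by (auto simp: k_def)
  then have "finite (k ` gterms Q)"
    using h(1) unfolding finite_congruence_def by (meson finite_Pow_iff finite_subset)
  then have "finite_congruence Q k"
    using sub by (intro finite_congruenceI subset_antisym) simp_all
  moreover have "saturates Q k {t \<in> gterms Q. \<exists>s \<in> V \<inter> gterms Q. of_term s \<preceq> of_term t}"
    unfolding saturates_def
  proof (intro ballI impI)
    fix t t' assume t: "t' \<in> gterms Q" "k t = k t'"
      "t \<in> {t \<in> gterms Q. \<exists>s \<in> V \<inter> gterms Q. of_term s \<preceq> of_term t}"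
    then obtain s where s: "s \<in> V" "s \<in> gterms Q" "of_term s \<preceq> of_term t" by blast
    then have "h s \<in> k t'" using t(2) kI by blast
    then obtain s' where "h s = h s'" "s' \<in> gterms Q" "of_term s' \<preceq> of_term t'"
      using kE by blast
    then show "t' \<in> {t \<in> gterms Q. \<exists>s \<in> V \<inter> gterms Q. of_term s \<preceq> of_term t}"
      using saturatesD[OF h(2)] s t(1) by blast
  qed
  ultimately show ?thesis by (rule recognizableI)
qed

primrec subterms :: "'q tm \<Rightarrow> 'q tm set" where
  "subterms (Var x) = {Var x}"
| "subterms E = {E}"
| "subterms (F q t1 t2) = insert (F q t1 t2) (subterms t1 \<union> subterms t2)"

lemma finite_subterms: "finite (subterms t)"
  by (induction t) auto

lemma self_in_subterms: "t \<in> subterms t"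
  by (cases t) auto

lemma subterms_F: "F q s1 s2 \<in> subterms t \<Longrightarrow> s1 \<in> subterms t \<and> s2 \<in> subterms t"
  by (induction t) (auto simp: self_in_subterms)

lemma subterms_gterms: "t \<in> gterms Q \<Longrightarrow> s \<in> subterms t \<Longrightarrow> s \<in> gterms Q"
  by (induction rule: gterms.induct) auto

text \<open>Both sides of an instance have the same shape and differ only in labels from
  \<open>Q\<close>. The conjunct on \<open>E\<close> carries the induction through nodes whose two
  children are \<open>e\<close>.\<close>

lemma inst_preserves:
  "inst \<rho>1 \<rho>2 t t' \<Longrightarrow> \<rho>1 \<in> gterms Q \<Longrightarrow> \<rho>2 \<in> gterms Q \<Longrightarrow>
    (t \<in> gterms Q \<longleftrightarrow> t' \<in> gterms Q) \<and> (t \<in> cterms Q \<longleftrightarrow> t' \<in> cterms Q) \<and> (t = E \<longleftrightarrow> t' = E)"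
  by (induction rule: inst.induct) (auto simp: F_in_cterms_iff)

lemma tstep_preserves:
  assumes "P \<subseteq> gterms Q \<times> gterms Q" "tstep P t t'"
  shows "(t \<in> gterms Q \<longleftrightarrow> t' \<in> gterms Q) \<and> (t \<in> cterms Q \<longleftrightarrow> t' \<in> cterms Q) \<and> (t = E \<longleftrightarrow> t' = E)"
  using assms(2)
proof induction
  case (root \<rho>1 \<rho>2 t t')
  then show ?case using inst_preserves[of \<rho>1 \<rho>2 t t'] assms(1) by blast
qed (auto simp: F_in_cterms_iff)

text \<open>A step of \<open>F q t1 t2\<close> inside a child is visible in the successor classes of
  that child and the \<open>h\<close>-class of the other one. A step at the root splits into matches
  of the rule's arguments against \<open>t1\<close> and \<open>t2\<close>, and these must be
  recorded as well.\<close>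

lemma recognizable_tstep:
  assumes "recognizable Q V" and P: "finite P" "P \<subseteq> gterms Q \<times> gterms Q"
  shows "recognizable Q {t \<in> gterms Q. \<exists>t'\<in>V. tstep P t t'}"
proof -
  obtain h :: "_ \<Rightarrow> nat" where h: "finite_congruence Q h" "saturates Q h V"
    using assms unfolding recognizable_def by blast
  \<comment> \<open>A finite set containing all sides of rules and closed under arguments
    (\<open>XF\<close>), so the argument pairs met while descending into a rule remain in the finite
    set \<open>X \<times> X\<close>.\<close>
  define X where "X = (\<Union>\<rho>\<in>fst ` P \<union> snd ` P. subterms \<rho>)"
  have "fst ` P \<union> snd ` P \<subseteq> gterms Q" using P(2) by auto
  then have X: "finite X" "X \<subseteq> gterms Q"
    using P(1) subterms_gterms unfolding X_def by (simp add: finite_subterms, blast)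
  have "fst ` P \<union> snd ` P \<subseteq> X" unfolding X_def using self_in_subterms by blast
  then have PX: "P \<subseteq> X \<times> X" by (auto simp: subset_iff)
  have XF: "s1 \<in> X \<and> s2 \<in> X" if F: "F q s1 s2 \<in> X" for q s1 s2
  proof -
    obtain \<rho> where "\<rho> \<in> fst ` P \<union> snd ` P" "F q s1 s2 \<in> subterms \<rho>"
      using F unfolding X_def by blast
    then show ?thesis using subterms_F[of q s1 s2 \<rho>] unfolding X_def by blast
  qed
  define m where "m t = {(a, b, h u) | a b u. a \<in> X \<and> b \<in> X \<and> inst a b t u}" for t
  \<comment> \<open>Without the component \<open>m\<close>, which records partial matches of the rules, \<open>k\<close> is no congruence.\<close>
  define k where "k t = (h t, m t, {h u | u. tstep P t u})" for t
  have kD: "h t = h t'" "m t = m t'" "{h u | u. tstep P t u} = {h u | u. tstep P t' u}"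
    if "k t = k t'" for t t'
    using that unfolding k_def by blast+
  have mI: "(a, b, h u) \<in> m t" if "a \<in> X" "b \<in> X" "inst a b t u" for a b t u
    using that unfolding m_def by blast
  have mE: "\<exists>u. x = h u \<and> inst a b t u" if "(a, b, x) \<in> m t" for a b x t
    using that unfolding m_def by blast
  have inst_cong: "\<exists>u'. inst a b (F q t1' t2') u' \<and> h u = h u'"
    if q: "q \<in> Q" and t: "t1 \<in> gterms Q" "t2 \<in> gterms Q" "t1' \<in> gterms Q" "t2' \<in> gterms Q"
      and k: "k t1 = k t1'" "k t2 = k t2'" and ab: "a \<in> X" "b \<in> X" and u: "inst a b (F q t1 t2) u"
    for q t1 t2 t1' t2' a b u
    using u
  proof cases
    \<comment> \<open>The pair \<open>(E, E)\<close> matches any term and leaves it unchanged, so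
      its result class is the \<open>h\<close>-class of the term itself.\<close>
    case E
    then show ?thesis
      using finite_congruenceD[OF h(1) q t kD(1)[OF k(1)] kD(1)[OF k(2)]] inst.E by blast
  next
    case (F \<rho>1 \<rho>3 t3 \<rho>2 \<rho>4 t4 q')
    then have b: "b = F q' \<rho>3 \<rho>4" "inst \<rho>2 \<rho>4 t2 t4" by blast+
    have mem: "\<rho>1 \<in> X" "\<rho>2 \<in> X" "\<rho>3 \<in> X" "\<rho>4 \<in> X"
      using XF ab F(1) b(1) by blast+
    have "(\<rho>1, \<rho>3, h t3) \<in> m t1'" "(\<rho>2, \<rho>4, h t4) \<in> m t2'"
      using mI mem F b(2) kD(2)[OF k(1)] kD(2)[OF k(2)] by blast+
    then obtain u1 u2 where u: "inst \<rho>1 \<rho>3 t1' u1" "h t3 = h u1" "inst \<rho>2 \<rho>4 t2' u2" "h t4 = h u2"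
      using mE by meson
    have g: "\<rho>1 \<in> gterms Q" "\<rho>2 \<in> gterms Q" "\<rho>3 \<in> gterms Q" "\<rho>4 \<in> gterms Q" "q' \<in> Q"
      using mem X(2) ab b(1) by auto
    have "t3 \<in> gterms Q" "t4 \<in> gterms Q" "u1 \<in> gterms Q" "u2 \<in> gterms Q"
      using inst_preserves[OF _ g(1,3)] inst_preserves[OF _ g(2,4)] F b u t by blast+
    then have "h (F q' t3 t4) = h (F q' u1 u2)"
      using finite_congruenceD[OF h(1) g(5)] u by blast
    moreover have "inst a b (F q t1' t2') (F q' u1 u2)"
      using F b u by (auto intro: inst.F)
    ultimately show ?thesis using F b by blast
  qed
  have step_cong: "\<exists>u'. tstep P (F q t1' t2') u' \<and> h u = h u'"
    if q: "q \<in> Q" and t: "t1 \<in> gterms Q" "t2 \<in> gterms Q" "t1' \<in> gterms Q" "t2' \<in> gterms Q"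
      and k: "k t1 = k t1'" "k t2 = k t2'" and u: "tstep P (F q t1 t2) u"
    for q t1 t2 t1' t2' u
    using u
  proof cases
    case (root \<rho>1 \<rho>2)
    then have "\<rho>1 \<in> X" "\<rho>2 \<in> X" using PX by auto
    then show ?thesis using inst_cong[OF q t k] root by (blast intro: tstep.root)
  next
    case (left u1)
    then have "h u1 \<in> {h u | u. tstep P t1' u}" unfolding kD(3)[OF k(1), symmetric] by blast
    then obtain u1' where u1': "h u1 = h u1'" "tstep P t1' u1'" by blast
    have "u1 \<in> gterms Q" "u1' \<in> gterms Q"
      using tstep_preserves[OF P(2)] left u1' t by blast+
    from finite_congruenceD[OF h(1) q this(1) t(2) this(2) t(4) u1'(1) kD(1)[OF k(2)]]
    have "h (F q u1 t2) = h (F q u1' t2')" .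
    then show ?thesis using left u1' by (blast intro: tstep.left)
  next
    case (right u2)
    then have "h u2 \<in> {h u | u. tstep P t2' u}" unfolding kD(3)[OF k(2), symmetric] by blast
    then obtain u2' where u2': "h u2 = h u2'" "tstep P t2' u2'" by blast
    have "u2 \<in> gterms Q" "u2' \<in> gterms Q"
      using tstep_preserves[OF P(2)] right u2' t by blast+
    from finite_congruenceD[OF h(1) q t(1) this(1) t(3) this(2) kD(1)[OF k(1)] u2'(1)]
    have "h (F q t1 u2) = h (F q t1' u2')" .
    then show ?thesis using right u2' by (blast intro: tstep.right)
  qed
  have cong: "k (F q t1 t2) = k (F q t1' t2')"
    if q: "q \<in> Q" and t: "t1 \<in> gterms Q" "t2 \<in> gterms Q" "t1' \<in> gterms Q" "t2' \<in> gterms Q"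
      and k: "k t1 = k t1'" "k t2 = k t2'" for q t1 t2 t1' t2'
  proof -
    \<comment> \<open>The assumptions are symmetric; exchanging the two terms gives the reverse
      inclusions.\<close>
    note t' = t(3,4,1,2) and k' = k[symmetric]
    have "h (F q t1 t2) = h (F q t1' t2')"
      using finite_congruenceD[OF h(1) q t] kD(1) k by blast
    moreover have "m (F q t1 t2) \<subseteq> m (F q t1' t2')" "m (F q t1' t2') \<subseteq> m (F q t1 t2)"
      unfolding m_def using inst_cong[OF q t k] inst_cong[OF q t' k'] by fast+
    moreover have "{h u | u. tstep P (F q t1 t2) u} = {h u | u. tstep P (F q t1' t2') u}"
      using step_cong[OF q t k] step_cong[OF q t' k'] by fast
    ultimately show ?thesis unfolding k_def by blast
  qed
  have fin: "finite (h ` gterms Q)"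
    using h(1) unfolding finite_congruence_def by blast
  have "k t \<in> h ` gterms Q \<times> Pow (X \<times> X \<times> h ` gterms Q) \<times> Pow (h ` gterms Q)"
    if "t \<in> gterms Q" for t
  proof -
    have "u \<in> gterms Q" if "a \<in> X" "b \<in> X" "inst a b t u" for a b u
      using inst_preserves[of a b t u Q] X(2) that \<open>t \<in> gterms Q\<close> by blast
    moreover have "u \<in> gterms Q" if "tstep P t u" for u
      using tstep_preserves[OF P(2) that] \<open>t \<in> gterms Q\<close> by blast
    ultimately show ?thesis using that unfolding k_def m_def by blast
  qed
  then have "k ` gterms Q \<subseteq> h ` gterms Q \<times> Pow (X \<times> X \<times> h ` gterms Q) \<times> Pow (h ` gterms Q)"
    by blast
  then have "finite (k ` gterms Q)"
    by (rule finite_subset) (simp add: fin X(1))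
  then have "finite_congruence Q k"
    using cong by (rule finite_congruenceI)
  moreover have "saturates Q k {t \<in> gterms Q. \<exists>t'\<in>V. tstep P t t'}"
    unfolding saturates_def
  proof (intro ballI impI)
    fix t t' assume t: "t \<in> gterms Q" "t' \<in> gterms Q" "k t = k t'"
      "t \<in> {t \<in> gterms Q. \<exists>t'\<in>V. tstep P t t'}"
    then obtain u where u: "u \<in> V" "tstep P t u" by blast
    then have "h u \<in> {h u | u. tstep P t' u}" unfolding kD(3)[OF t(3), symmetric] by blast
    then obtain u' where u': "h u = h u'" "tstep P t' u'" by blast
    then have "u \<in> gterms Q" "u' \<in> gterms Q"
      using tstep_preserves[OF P(2)] u t by blast+
    then show "t' \<in> {t \<in> gterms Q. \<exists>t'\<in>V. tstep P t t'}"
      using saturatesD[OF h(2)] u u' t(2) by blast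
  qed
  ultimately show ?thesis by (rule recognizableI)
qed

section \<open>Predecessor sets on terms\<close>

definition tree_terms :: "'q set \<Rightarrow> 'q tree set \<Rightarrow> 'q tm set" where
  "tree_terms Q U = {t \<in> cterms Q. of_term t \<in> U}"

lemma complete_tree_iff: "complete_tree Q \<tau> \<longleftrightarrow> (\<exists>t\<in>cterms Q. \<tau> = of_term t)"
  using tree_term_complete of_term_complete by metis

text \<open>The right-hand side is arranged so that the closure lemmas for intersection,
  \<open>tstep\<close> and embedding apply to it literally. The inner \<open>cterms Q\<close>
  reflects that the configuration from which the concrete step starts is complete.\<close>

lemma tree_terms_Pre:
  assumes R: "\<forall>r\<in>R. is_tree (Q \<times> Q) r"
  shows "tree_terms Q (Pre Q R U) =
    cterms Q \<inter> {t \<in> gterms Q. \<exists>s \<in> (cterms Q \<inter>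
      {s \<in> gterms Q. \<exists>s'\<in>tree_terms Q U. tstep (\<Union>r\<in>R. rule_terms r) s s'}) \<inter> gterms Q.
      of_term s \<preceq> of_term t}"
proof -
  let ?step = "tstep (\<Union>r\<in>R. rule_terms r)"
  have P: "(\<Union>r\<in>R. rule_terms r) \<subseteq> gterms Q \<times> gterms Q"
    using R rule_terms_gterms by fastforce
  have "of_term t \<in> Pre Q R U \<longleftrightarrow>
      (\<exists>s\<in>cterms Q. of_term s \<preceq> of_term t \<and> (\<exists>s'\<in>tree_terms Q U. ?step s s'))"
    if t: "t \<in> cterms Q" for t
  proof -
    have "of_term t \<in> Pre Q R U \<longleftrightarrow> (\<exists>s\<in>cterms Q. of_term s \<preceq> of_term t \<and>
        (\<exists>\<tau>'\<in>U. complete_tree Q \<tau>' \<and> step Q R (of_term s) \<tau>'))"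
      using t unfolding Pre_def abstract_step_def complete_tree_iff by blast
    moreover have "(\<exists>\<tau>'\<in>U. complete_tree Q \<tau>' \<and> step Q R (of_term s) \<tau>') \<longleftrightarrow>
        (\<exists>s'\<in>tree_terms Q U. ?step s s')" if s: "s \<in> cterms Q" for s
    proof -
      have eq: "step Q R (of_term s) \<tau>' \<longleftrightarrow> (\<exists>t'. of_term t' = \<tau>' \<and> ?step s t')" for \<tau>'
        using step_of_term_iff[OF R] of_term_complete[OF s] by blast
      have "s' \<in> cterms Q" if "?step s s'" for s'
        using tstep_preserves[OF P that] s by blast
      then show ?thesis
        unfolding eq tree_terms_def using complete_tree_iff by blast
    qed
    ultimately show ?thesis by blast
  qed
  then show ?thesis
    using cterms_subset_gterms unfolding tree_terms_def[of Q "Pre Q R U"] by blast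
qed

section \<open>The finite model\<close>

text \<open>Contexts grow at the hole rather than at the root. Thus a frame around the hole of any
  given context is again a context, which is the form needed in \<open>ctx_le_F\<close>.\<close>

inductive_set contexts :: "'q set \<Rightarrow> ('q tm \<Rightarrow> 'q tm) set" for Q where
  hole: "(\<lambda>t. t) \<in> contexts Q"
| left: "C \<in> contexts Q \<Longrightarrow> q \<in> Q \<Longrightarrow> s \<in> gterms Q \<Longrightarrow> (\<lambda>t. C (F q t s)) \<in> contexts Q"
| right: "C \<in> contexts Q \<Longrightarrow> q \<in> Q \<Longrightarrow> s \<in> gterms Q \<Longrightarrow> (\<lambda>t. C (F q s t)) \<in> contexts Q"

text \<open>The syntactic preorder of \<open>V\<close>, oriented like reachability: badness travels
  backwards, from the target \<open>t'\<close> to the source \<open>t\<close>.\<close>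

definition ctx_le :: "'q set \<Rightarrow> 'q tm set \<Rightarrow> 'q tm \<Rightarrow> 'q tm \<Rightarrow> bool" where
  "ctx_le Q V t t' \<longleftrightarrow> (\<forall>C\<in>contexts Q. C t' \<in> V \<longrightarrow> C t \<in> V)"

lemma ctx_leD: "ctx_le Q V t t' \<Longrightarrow> C \<in> contexts Q \<Longrightarrow> C t' \<in> V \<Longrightarrow> C t \<in> V"
  by (simp add: ctx_le_def)

lemma contexts_gterms: "C \<in> contexts Q \<Longrightarrow> t \<in> gterms Q \<Longrightarrow> C t \<in> gterms Q"
  by (induction arbitrary: t rule: contexts.induct) auto

lemma contexts_cong:
  assumes "finite_congruence Q h" "C \<in> contexts Q"
  shows "t \<in> gterms Q \<Longrightarrow> t' \<in> gterms Q \<Longrightarrow> h t = h t' \<Longrightarrow> h (C t) = h (C t')"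
  using assms(2)
proof (induction arbitrary: t t' rule: contexts.induct)
  case (left C q s)
  have "h (F q t s) = h (F q t' s)"
    using left.hyps left.prems by (intro finite_congruenceD[OF assms(1)]) simp_all
  then show ?case
    using left.hyps left.prems by (intro left.IH) simp_all
next
  case (right C q s)
  have "h (F q s t) = h (F q s t')"
    using right.hyps right.prems by (intro finite_congruenceD[OF assms(1)]) simp_all
  then show ?case
    using right.hyps right.prems by (intro right.IH) simp_all
qed

lemma contexts_tstep: "C \<in> contexts Q \<Longrightarrow> tstep P t t' \<Longrightarrow> tstep P (C t) (C t')"
  by (induction arbitrary: t t' rule: contexts.induct) (auto intro: tstep.intros)

lemma ctx_le_refl: "ctx_le Q V t t"
  by (simp add: ctx_le_def)

lemma ctx_le_trans: "ctx_le Q V s t \<Longrightarrow> ctx_le Q V t u \<Longrightarrow> ctx_le Q V s u"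
  by (simp add: ctx_le_def)

text \<open>One argument is exchanged at a time, with \<open>F q s t'\<close> in between: first with
  \<open>t'\<close> as fixed sibling, then with \<open>s\<close>. Only these two have to be
  ground.\<close>

lemma ctx_le_F:
  assumes "ctx_le Q V s s'" "ctx_le Q V t t'" "q \<in> Q" "s \<in> gterms Q" "t' \<in> gterms Q"
  shows "ctx_le Q V (F q s t) (F q s' t')"
  unfolding ctx_le_def
proof (intro ballI impI)
  fix C assume C: "C \<in> contexts Q" "C (F q s' t') \<in> V"
  then have "C (F q s t') \<in> V"
    using ctx_leD[OF assms(1) contexts.left[OF C(1) assms(3,5)]] by simp
  then show "C (F q s t) \<in> V"
    using ctx_leD[OF assms(2) contexts.right[OF C(1) assms(3,4)]] by simp
qed

text \<open>Well-definedness of the reachability relation on classes: contexts preserve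
  \<open>h\<close>-equivalence, and \<open>V\<close> is a union of classes on ground terms.\<close>

lemma ctx_le_saturated:
  assumes "finite_congruence Q h" "saturates Q h V"
    and "s \<in> gterms Q" "s' \<in> gterms Q" "t \<in> gterms Q" "t' \<in> gterms Q"
    and "h s = h s'" "h t = h t'" "ctx_le Q V s t"
  shows "ctx_le Q V s' t'"
  unfolding ctx_le_def
proof (intro ballI impI)
  fix C assume C: "C \<in> contexts Q" "C t' \<in> V"
  note g = contexts_gterms[OF C(1)] and cong = contexts_cong[OF assms(1) C(1)]
  have "C t \<in> V"
    using saturatesD[OF assms(2) g[OF assms(6)] g[OF assms(5)] _ C(2)]
      cong[OF assms(5,6,8)] by simp
  with assms(9) C(1) have "C s \<in> V" by (rule ctx_leD)
  then show "C s' \<in> V"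
    using saturatesD[OF assms(2) g[OF assms(3)] g[OF assms(4)] cong[OF assms(3,4,7)]] by simp
qed

lemma ctx_le_tstep:
  assumes "\<And>t t'. tstep P t t' \<Longrightarrow> t' \<in> V \<Longrightarrow> t \<in> V" "tstep P t t'"
  shows "ctx_le Q V t t'"
  unfolding ctx_le_def using assms contexts_tstep by blast

section \<open>Substitutions and universal closures\<close>

primrec subst :: "(nat \<Rightarrow> 'q tm) \<Rightarrow> 'q tm \<Rightarrow> 'q tm" where
  "subst \<sigma> (Var x) = \<sigma> x"
| "subst \<sigma> E = E"
| "subst \<sigma> (F q t1 t2) = F q (subst \<sigma> t1) (subst \<sigma> t2)"

text \<open>The two components of a rule pair have \<open>e\<close> at the same positions, and
  \<open>gen\<close> names variables by position. So any substitution puts the same term at both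
  places. The start position \<open>p\<close> is general for the sake of the recursion into
  children.\<close>

lemma inst_subst_gen:
  "(\<rho>1, \<rho>2) \<in> rule_terms r \<Longrightarrow> is_tree A r \<Longrightarrow>
    inst \<rho>1 \<rho>2 (subst \<sigma> (gen p \<rho>1)) (subst \<sigma> (gen p \<rho>2))"
proof (rotate_tac, induction arbitrary: p \<rho>1 \<rho>2 rule: is_tree_induct)
  case (leaf r a)
  moreover have "finite (dom r)" using leaf unfolding is_tree_def by auto
  ultimately show ?case by (cases a) (auto simp: rule_terms_leaf intro!: inst.intros)
next
  case (single r a)
  moreover have "finite (dom r)" using single unfolding is_tree_def by auto
  ultimately show ?case by (cases a) (auto simp: rule_terms_single intro!: inst.intros)
next
  case (both r a)
  moreover have "finite (dom r)" using both unfolding is_tree_def by auto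
  ultimately show ?case by (cases a) (auto simp: rule_terms_both intro!: inst.intros)
qed

lemma subst_gen_gterms: "\<rho> \<in> gterms Q \<Longrightarrow> range \<sigma> \<subseteq> gterms Q \<Longrightarrow> subst \<sigma> (gen p \<rho>) \<in> gterms Q"
  by (induction arbitrary: p rule: gterms.induct) auto

lemma sat_univ_closure:
  assumes "\<And>v. range v \<subseteq> univ M \<Longrightarrow> sat M v \<phi>" "range v \<subseteq> univ M"
  shows "sat M v (univ_closure \<phi>)"
proof -
  have "sat M v (foldr All xs \<phi>)" for xs
    using assms(2)
  proof (induction xs arbitrary: v)
    case (Cons x xs)
    have "range (v(x := a)) \<subseteq> univ M" if "a \<in> univ M" for a
      using Cons.prems that by (auto simp: image_subset_iff)
    then show ?case using Cons.IH by simp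
  qed (use assms(1) in simp)
  then show ?thesis by (simp add: univ_closure_def)
qed

text \<open>The quotient, with classes named by values of \<open>h\<close> and functions computed on
  representatives chosen by \<open>inv_into\<close>. The state and acceptance predicates are
  restricted to complete terms: the automata may also accept incomplete ones, about which the sets
  \<open>Init\<close> and \<open>Unsafe\<close> of configurations say nothing.\<close>

definition term_model ::
  "'q set \<Rightarrow> ('q tm \<Rightarrow> 'b) \<Rightarrow> 'q tm set \<Rightarrow> ('q, 'i) ta \<Rightarrow> ('q, 'u) ta \<Rightarrow>
     ('b, 'q, ('i, 'u) psym) struct" where
  "term_model Q h V A\<^sub>I A\<^sub>U =
     \<lparr>univ = h ` gterms Q,
      const_e = h E,
      fun_f = (\<lambda>q a b. h (F q (inv_into (gterms Q) h a) (inv_into (gterms Q) h b))),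
      rel = (\<lambda>p as. case p of
          Reach \<Rightarrow> (\<exists>t\<in>gterms Q. \<exists>t'\<in>gterms Q. as = [h t, h t'] \<and> ctx_le Q V t t')
        | IState \<theta> \<Rightarrow> (\<exists>t\<in>cterms Q. as = [h t] \<and> run A\<^sub>I t \<theta>)
        | Init \<Rightarrow> (\<exists>t\<in>cterms Q. as = [h t] \<and> t \<in> language A\<^sub>I)
        | UState \<theta> \<Rightarrow> (\<exists>t\<in>cterms Q. as = [h t] \<and> run A\<^sub>U t \<theta>)
        | Unsafe \<Rightarrow> (\<exists>t\<in>cterms Q. as = [h t] \<and> t \<in> language A\<^sub>U))\<rparr>"

context
  fixes Q :: "'q set" and h :: "'q tm \<Rightarrow> 'b" and V :: "'q tm set"
    and A\<^sub>I :: "('q, 'i) ta" and A\<^sub>U :: "('q, 'u) ta" and M :: "('b, 'q, ('i, 'u) psym) struct"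
  assumes h: "finite_congruence Q h"
    and M: "M = term_model Q h V A\<^sub>I A\<^sub>U"
begin

lemma univ_M: "univ M = h ` gterms Q"
  by (simp add: M term_model_def)

lemma const_e_M: "const_e M = h E"
  by (simp add: M term_model_def)

lemma fun_f_M:
  assumes "q \<in> Q" "t1 \<in> gterms Q" "t2 \<in> gterms Q"
  shows "fun_f M q (h t1) (h t2) = h (F q t1 t2)"
proof -
  have inv: "inv_into (gterms Q) h (h t) \<in> gterms Q" "h (inv_into (gterms Q) h (h t)) = h t"
    if "t \<in> gterms Q" for t
    using inv_into_into[OF imageI[OF that]] f_inv_into_f[OF imageI[OF that]] by auto
  show ?thesis
    using finite_congruenceD[OF h assms(1) inv(1)[OF assms(2)] inv(1)[OF assms(3)] assms(2,3)
      inv(2)[OF assms(2)] inv(2)[OF assms(3)]]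
    by (simp add: M term_model_def)
qed

lemma is_struct_M: "is_struct Q M"
  unfolding is_struct_def univ_M const_e_M
proof (intro conjI ballI)
  show "h ` gterms Q \<noteq> {}" "h E \<in> h ` gterms Q"
    using gterms.E by blast+
next
  fix q a b assume q: "q \<in> Q" and "a \<in> h ` gterms Q" "b \<in> h ` gterms Q"
  then obtain t1 t2 where t: "a = h t1" "t1 \<in> gterms Q" "b = h t2" "t2 \<in> gterms Q"
    by blast
  then show "fun_f M q a b \<in> h ` gterms Q"
    using fun_f_M[OF q t(2,4)] gterms.F[OF q t(2,4)] by simp
qed

lemma eval_tm_M:
  assumes "subst \<sigma> t \<in> gterms Q" "range \<sigma> \<subseteq> gterms Q" "v = (\<lambda>x. h (\<sigma> x))"
  shows "eval_tm M v t = h (subst \<sigma> t)"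
  using assms(1)
proof (induction t)
  case E
  then show ?case by (simp add: const_e_M)
qed (use assms(2,3) fun_f_M in auto)

text \<open>Valuations lift to ground substitutions by choosing representatives; with
  \<open>eval_tm_M\<close>, statements about the model become statements about terms.\<close>

lemma valuation_M:
  assumes "range v \<subseteq> univ M"
  shows "\<exists>\<sigma>. range \<sigma> \<subseteq> gterms Q \<and> v = (\<lambda>x. h (\<sigma> x))"
proof (intro exI conjI)
  show "range (\<lambda>x. inv_into (gterms Q) h (v x)) \<subseteq> gterms Q"
    using assms unfolding univ_M by (auto intro!: inv_into_into)
  have "v x \<in> h ` gterms Q" for x
    using assms unfolding univ_M by blast
  then show "v = (\<lambda>x. h (inv_into (gterms Q) h (v x)))"
    by (simp add: f_inv_into_f)
qed

text \<open>Kept generic in \<open>P\<close> and \<open>Acc\<close> so that one argument serves both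
  automata. Runs on complete terms are closed under the clauses, since \<open>F q E E\<close> and
  nodes over complete terms are complete.\<close>

lemma sat_Phi_A:
  assumes A: "tree_automaton Q A"
    and P: "\<And>\<theta> a. rel M (P \<theta>) [a] \<longleftrightarrow> (\<exists>t\<in>cterms Q. a = h t \<and> run A t \<theta>)"
    and Acc: "\<And>a. rel M Acc [a] \<longleftrightarrow> (\<exists>t\<in>cterms Q. a = h t \<and> t \<in> language A)"
    and \<phi>: "\<phi> \<in> Phi_A A P Acc" and v: "range v \<subseteq> univ M"
  shows "sat M v \<phi>"
proof -
  have fin: "finite (final A)"
    using A unfolding tree_automaton_def by (meson finite_subset)
  have 1: "sat M v (univ_closure (Atom (P \<theta>) [F q E E]))"
    if "\<theta>' \<in> leaf_rules A" "(q, \<theta>', \<theta>', \<theta>) \<in> node_rules A" for q \<theta> \<theta>'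
  proof (rule sat_univ_closure[OF _ v])
    fix v
    have "q \<in> Q" using A that unfolding tree_automaton_def by blast
    then have "F q E E \<in> cterms Q" "fun_f M q (h E) (h E) = h (F q E E)"
      using fun_f_M by (auto simp: F_in_cterms_iff)
    moreover have "run A (F q E E) \<theta>"
      using that by (auto intro: run.intros)
    ultimately show "sat M v (Atom (P \<theta>) [F q E E])" by (auto simp: P const_e_M)
  qed
  have 2: "sat M v (univ_closure (Imp (And (Atom (P \<theta>1) [Var 0]) (Atom (P \<theta>2) [Var 1]))
      (Atom (P \<theta>3) [F q (Var 0) (Var 1)])))"
    if "(q, \<theta>1, \<theta>2, \<theta>3) \<in> node_rules A" for q \<theta>1 \<theta>2 \<theta>3
  proof (rule sat_univ_closure[OF _ v])
    fix v
    have q: "q \<in> Q" using A that unfolding tree_automaton_def by blast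
    have "\<exists>t\<in>cterms Q. fun_f M q (h t1) (h t2) = h t \<and> run A t \<theta>3"
      if "t1 \<in> cterms Q" "t2 \<in> cterms Q" "run A t1 \<theta>1" "run A t2 \<theta>2" for t1 t2
      using that q fun_f_M[OF q] cterms_subset_gterms \<open>(q, \<theta>1, \<theta>2, \<theta>3) \<in> node_rules A\<close>
      by (intro bexI[of _ "F q t1 t2"]) (auto simp: F_in_cterms_iff run_F_iff)
    then show "sat M v (Imp (And (Atom (P \<theta>1) [Var 0]) (Atom (P \<theta>2) [Var 1]))
        (Atom (P \<theta>3) [F q (Var 0) (Var 1)]))"
      by (auto simp: P)
  qed
  have 3: "sat M v (univ_closure
      (Imp (BigOr (\<lambda>\<theta>. Atom (P \<theta>) [Var 0]) (final A)) (Atom Acc [Var 0])))"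
    by (rule sat_univ_closure[OF _ v]) (auto simp: sat_BigOr[OF fin] P Acc language_def)
  show ?thesis
    using \<phi> unfolding Phi_A_def
    by (elim UnE CollectE exE conjE singletonE) (simp_all only: 1 2 3)
qed

lemma sat_Phi_R:
  assumes sat: "saturates Q h V"
    and R: "\<forall>r\<in>R. is_tree (Q \<times> Q) r"
    and V: "\<And>t t'. tstep (\<Union>r\<in>R. rule_terms r) t t' \<Longrightarrow> t' \<in> V \<Longrightarrow> t \<in> V"
    and \<phi>: "\<phi> \<in> Phi_R Q R" and v: "range v \<subseteq> univ M"
  shows "sat M v \<phi>"
proof -
  \<comment> \<open>By saturation the choice of representatives is irrelevant, so each axiom reduces
    to a property of \<open>ctx_le\<close>.\<close>
  have reach: "rel M Reach [h t, h t'] \<longleftrightarrow> ctx_le Q V t t'"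
    if t: "t \<in> gterms Q" "t' \<in> gterms Q" for t t'
  proof
    assume "rel M Reach [h t, h t']"
    then obtain s s' where "s \<in> gterms Q" "s' \<in> gterms Q" "h s = h t" "h s' = h t'" "ctx_le Q V s s'"
      unfolding M term_model_def by (simp, metis)
    then show "ctx_le Q V t t'"
      using ctx_le_saturated[OF h sat _ t(1) _ t(2)] by blast
  next
    assume "ctx_le Q V t t'"
    then show "rel M Reach [h t, h t']"
      using t unfolding M term_model_def by auto
  qed
  have 1: "sat M v (univ_closure (Atom Reach [gen [] \<rho>1, gen [] \<rho>2]))"
    if r: "r \<in> R" "(\<rho>1, \<rho>2) \<in> rule_terms r" for r \<rho>1 \<rho>2
  proof (rule sat_univ_closure[OF _ v])
    fix v :: "nat \<Rightarrow> 'b" assume "range v \<subseteq> univ M"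
    then obtain \<sigma> where \<sigma>: "range \<sigma> \<subseteq> gterms Q" "v = (\<lambda>x. h (\<sigma> x))"
      using valuation_M by blast
    let ?t = "subst \<sigma> (gen [] \<rho>1)" and ?t' = "subst \<sigma> (gen [] \<rho>2)"
    have "is_tree (Q \<times> Q) r" using R r(1) by blast
    note gterms = rule_terms_gterms[OF this r(2)] and inst = inst_subst_gen[OF r(2) this, of \<sigma> "[]"]
    then have g: "?t \<in> gterms Q" "?t' \<in> gterms Q"
      using subst_gen_gterms[OF _ \<sigma>(1)] by blast+
    have "tstep (\<Union>r\<in>R. rule_terms r) ?t ?t'"
      using r inst by (blast intro: tstep.root)
    then have "ctx_le Q V ?t ?t'"
      using ctx_le_tstep[of "\<Union>r\<in>R. rule_terms r" V] V by blast
    then show "sat M v (Atom Reach [gen [] \<rho>1, gen [] \<rho>2])"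
      using reach[OF g] eval_tm_M[OF g(1) \<sigma>] eval_tm_M[OF g(2) \<sigma>] by simp
  qed
  have 2: "sat M v (univ_closure (Atom Reach [Var 0, Var 0]))"
  proof (rule sat_univ_closure[OF _ v])
    fix v :: "nat \<Rightarrow> 'b" assume "range v \<subseteq> univ M"
    then obtain \<sigma> where \<sigma>: "range \<sigma> \<subseteq> gterms Q" "v = (\<lambda>x. h (\<sigma> x))"
      using valuation_M by blast
    then have "\<sigma> x \<in> gterms Q" for x by blast
    then show "sat M v (Atom Reach [Var 0, Var 0])"
      by (simp add: \<sigma>(2) reach ctx_le_refl)
  qed
  have 3: "sat M v (univ_closure (Imp (And (Atom Reach [Var 0, Var 1]) (Atom Reach [Var 1, Var 2]))
      (Atom Reach [Var 0, Var 2])))"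
  proof (rule sat_univ_closure[OF _ v])
    fix v :: "nat \<Rightarrow> 'b" assume "range v \<subseteq> univ M"
    then obtain \<sigma> where \<sigma>: "range \<sigma> \<subseteq> gterms Q" "v = (\<lambda>x. h (\<sigma> x))"
      using valuation_M by blast
    then have "\<sigma> x \<in> gterms Q" for x by blast
    then show "sat M v (Imp (And (Atom Reach [Var 0, Var 1]) (Atom Reach [Var 1, Var 2]))
        (Atom Reach [Var 0, Var 2]))"
      using ctx_le_trans[of Q V "\<sigma> 0" "\<sigma> 1" "\<sigma> 2"] by (simp add: \<sigma>(2) reach)
  qed
  have 4: "sat M v (univ_closure (Imp (And (Atom Reach [Var 0, Var 1]) (Atom Reach [Var 2, Var 3]))
      (Atom Reach [F q (Var 0) (Var 2), F q (Var 1) (Var 3)])))" if q: "q \<in> Q" for q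
  proof (rule sat_univ_closure[OF _ v])
    fix v :: "nat \<Rightarrow> 'b" assume "range v \<subseteq> univ M"
    then obtain \<sigma> where \<sigma>: "range \<sigma> \<subseteq> gterms Q" "v = (\<lambda>x. h (\<sigma> x))"
      using valuation_M by blast
    then have g: "\<sigma> x \<in> gterms Q" for x by blast
    then show "sat M v (Imp (And (Atom Reach [Var 0, Var 1]) (Atom Reach [Var 2, Var 3]))
        (Atom Reach [F q (Var 0) (Var 2), F q (Var 1) (Var 3)]))"
      using ctx_le_F[of Q V "\<sigma> 0" "\<sigma> 1" "\<sigma> 2" "\<sigma> 3", OF _ _ q g g]
      by (simp add: \<sigma>(2) reach fun_f_M q)
  qed
  show ?thesis
    using \<phi> unfolding Phi_R_def
    by (elim UnE CollectE exE conjE singletonE) (simp_all only: 1 2 3 4)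
qed

text \<open>Saturation moves \<open>ctx_le\<close> to the accepted terms themselves; the trivial
  context then pulls the unsafe term's membership in \<open>V\<close> back to the initial
  one.\<close>

lemma sat_unreachable:
  assumes sat: "saturates Q h V"
    and "language A\<^sub>I \<inter> cterms Q \<inter> V = {}" "language A\<^sub>U \<inter> cterms Q \<subseteq> V"
  shows "sat M v (Neg (Ex 0 (Ex 1 (And (Atom Init [Var 0]) (And (Atom Unsafe [Var 1])
          (Atom Reach [Var 0, Var 1]))))))"
proof -
  have False if "t \<in> cterms Q" "t \<in> language A\<^sub>I" "t' \<in> cterms Q" "t' \<in> language A\<^sub>U"
    "s \<in> gterms Q" "s' \<in> gterms Q" "h t = h s" "h t' = h s'" "ctx_le Q V s s'" for t t' s s'
  proof -
    have "ctx_le Q V t t'"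
      using ctx_le_saturated[OF h sat] that cterms_subset_gterms by metis
    moreover have "t' \<in> V" using that assms(3) by blast
    ultimately have "t \<in> V"
      using ctx_leD[OF _ contexts.hole] by blast
    then show False using that assms(2) by blast
  qed
  then show ?thesis by (auto simp: M term_model_def) metis
qed

end

theorem theorem2:
  fixes Q :: "'q set"
    and R :: "('q \<times> 'q) tree set"
    and A\<^sub>I :: "('q, 'i) ta"
    and A\<^sub>U :: "('q, 'u) ta"
    and InitC UnsafeC :: "'q tree set"
    and U :: "nat \<Rightarrow> 'q tree set"
    and n :: nat
  assumes "parameterized_tree_system Q R"
    and "tree_automaton Q A\<^sub>I"
    and "InitC = {\<tau>. complete_tree Q \<tau> \<and> tree_term \<tau> \<in> language A\<^sub>I}"
    and "finitely_based Q UnsafeC"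
    and "tree_automaton Q A\<^sub>U"
    and "UnsafeC = {\<tau>. complete_tree Q \<tau> \<and> tree_term \<tau> \<in> language A\<^sub>U}"
    and "U 0 = UnsafeC"
    and "\<And>i. U (Suc i) = U i \<union> Pre Q R (U i)"
    and "U (Suc n) = U n"
    and "InitC \<inter> U n = {}"
  shows "\<exists>M :: (nat, 'q, ('i, 'u) psym) struct. finite_model Q M (safety_sentence Q R A\<^sub>I A\<^sub>U)"
proof -
  note sys = assms(1)[unfolded parameterized_tree_system_def]
  have R: "\<forall>r\<in>R. is_tree (Q \<times> Q) r" using sys by blast
  define P where "P = (\<Union>r\<in>R. rule_terms r)"
  have P: "finite P" "P \<subseteq> gterms Q \<times> gterms Q"
    using sys rule_terms_gterms unfolding P_def by (auto simp: finite_rule_terms) blast+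
  have lang: "tree_terms Q UnsafeC = language A\<^sub>U \<inter> cterms Q"
    "tree_terms Q InitC = language A\<^sub>I \<inter> cterms Q"
    using of_term_complete unfolding tree_terms_def assms(3,6) by force+
  have rec: "recognizable Q (tree_terms Q (U i))" for i
  proof (induction i)
    case 0
    show ?case
      unfolding assms(7) lang
      by (intro recognizable_Int recognizable_language recognizable_cterms assms(5))
  next
    case (Suc i)
    have "tree_terms Q (U (Suc i)) = tree_terms Q (U i) \<union> tree_terms Q (Pre Q R (U i))"
      unfolding assms(8) tree_terms_def by blast
    then show ?case
      unfolding tree_terms_Pre[OF R] using Suc
      by (simp only:) (intro recognizable_Un recognizable_Int recognizable_cterms
        recognizable_embeds_closure recognizable_tstep P[unfolded P_def])
  qed
  define V where "V = tree_terms Q (U n)"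
  obtain h :: "'q tm \<Rightarrow> nat" where h: "finite_congruence Q h" "saturates Q h V"
    using rec[of n] unfolding recognizable_def V_def by blast
  \<comment> \<open>\<open>t\<close> is complete because steps also reflect completeness. Embedding
    \<open>t\<close> into itself puts it into \<open>Pre Q R (U n)\<close>, which is contained in
    \<open>U (Suc n) = U n\<close>.\<close>
  have closed: "t \<in> V" if "tstep P t t'" "t' \<in> V" for t t'
  proof -
    have t: "t \<in> cterms Q"
      using tstep_preserves[OF P(2)] that unfolding V_def tree_terms_def by blast
    then have "t \<in> tree_terms Q (Pre Q R (U n))"
      unfolding tree_terms_Pre[OF R]
      using that embeds_refl[of "of_term t"] cterms_subset_gterms[OF t]
      unfolding V_def P_def by blast
    then have "of_term t \<in> U (Suc n)"
      unfolding assms(8) tree_terms_def by blast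
    then show ?thesis using t assms(9) unfolding V_def tree_terms_def by simp
  qed
  have "U 0 \<subseteq> U i" for i
    by (induction i) (use assms(8) in auto)
  then have unsafe: "language A\<^sub>U \<inter> cterms Q \<subseteq> V"
    unfolding lang(1)[symmetric] V_def tree_terms_def using assms(7) by blast
  have init: "language A\<^sub>I \<inter> cterms Q \<inter> V = {}"
    unfolding lang(2)[symmetric] V_def tree_terms_def using assms(10) by blast
  define M :: "(nat, 'q, ('i, 'u) psym) struct" where "M = term_model Q h V A\<^sub>I A\<^sub>U"
  have rel: "rel M (IState \<theta>) [a] \<longleftrightarrow> (\<exists>t\<in>cterms Q. a = h t \<and> run A\<^sub>I t \<theta>)"
    "rel M Init [a] \<longleftrightarrow> (\<exists>t\<in>cterms Q. a = h t \<and> t \<in> language A\<^sub>I)"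
    "rel M (UState \<theta>') [a] \<longleftrightarrow> (\<exists>t\<in>cterms Q. a = h t \<and> run A\<^sub>U t \<theta>')"
    "rel M Unsafe [a] \<longleftrightarrow> (\<exists>t\<in>cterms Q. a = h t \<and> t \<in> language A\<^sub>U)" for \<theta> \<theta>' a
    by (auto simp: M_def term_model_def)
  have "sat M v (safety_sentence Q R A\<^sub>I A\<^sub>U)" if v: "range v \<subseteq> univ M" for v
  proof -
    have "sat M v \<phi>" if "\<phi> \<in> Phi_R Q R" for \<phi>
      by (rule sat_Phi_R[OF h(1) M_def h(2) R _ that v]) (rule closed[unfolded P_def])
    moreover have "sat M v \<phi>" if "\<phi> \<in> Phi_I A\<^sub>I" for \<phi>
      by (rule sat_Phi_A[OF h(1) M_def assms(2) rel(1,2) that[unfolded Phi_I_def] v])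
    moreover have "sat M v \<phi>" if "\<phi> \<in> Phi_U A\<^sub>U" for \<phi>
      by (rule sat_Phi_A[OF h(1) M_def assms(5) rel(3,4) that[unfolded Phi_U_def] v])
    moreover have "finite (Phi_R Q R :: ('q, ('i, 'u) psym) fm set)"
      "finite (Phi_I A\<^sub>I :: ('q, ('i, 'u) psym) fm set)"
      "finite (Phi_U A\<^sub>U :: ('q, ('i, 'u) psym) fm set)"
      using finite_Phi_R[OF assms(1)] finite_Phi_A[OF _ assms(2)] finite_Phi_A[OF _ assms(5)] sys
      unfolding Phi_I_def Phi_U_def by blast+
    ultimately show ?thesis
      using sat_unreachable[OF h(1) M_def h(2) init unsafe, of v]
      \<comment> \<open>Negation and existential quantifiers stay folded so that the last conjunct
        matches \<open>sat_unreachable\<close>.\<close>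
      unfolding safety_sentence_def by (simp add: sat_BigAnd del: sat.simps(4,9))
  qed
  moreover have "is_struct Q M" "finite (univ M)"
    using is_struct_M[OF h(1) M_def] univ_M[OF h(1) M_def] h(1)
    unfolding finite_congruence_def by auto
  ultimately show ?thesis unfolding finite_model_def by blast
qed

end
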